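(* Let $x:[0,1]\to\mathbb{R}$ be the horizontal component of the Peano curve. Let $p=p'/q'$, where $p'$ and $q'$ are positive integers not divisible by $3$, and let $r\in\mathbb{R}$ be such that $r=\theta p$, where $\theta$ is a real number which is not an (integer) multiple of $3^{m}/p'$ for any $m\in\mathbb{Z}$. Then for every $t\in[0,1]$ $$\lim_{n\to+\infty}[x]_{t}^{3^{-n}p,\,3^{-n}r}=3^{\lfloor-\log_{3}p\rfloor}\,p\left(1-\frac{3}{4}\,3^{\lfloor-\log_{3}p\rfloor}\,p\right)t .$$
   Context: Horizontal component of the Peano curve: for $t\in[0,1]$ write a ternary expansion $t=\sum_{j\ge1}t_j3^{-j}$ with $t_j\in\{0,1,2\}$ (for $t=1$ all $t_j=2$). Let $\kappa:\{0,1,2\}\to\{0,1,2\}$, $\kappa(d)=2-d$, and let $\kappa^{v}$ be its $v$-th iterate ($\kappa^0=\mathrm{id}$). Then $$x(t)=\sum_{j\ge1}3^{-j}\,\kappa^{\,t_2+t_4+\dots+t_{2j-2}}(t_{2j-1}),$$ where for $j=1$ the exponent of $\kappa$ is $0$. The value does not depend on the choice of ternary expansion of $t$, and $x$ is a continuous function from $[0,1]$ onto $[0,1]$. Lebesgue partition: for $c>0$ and $r\in\mathbb{R}$ the grid is $c\mathbb{Z}+r=\{cq+r:q\in\mathbb{Z}\}$. For the continuous function $x:[0,1]\to\mathbb{R}$ define $t_1(c,r)=\inf\{t\in[0,1]:x(t)\in c\mathbb{Z}+r\}$ (with $\inf\emptyset=+\infty$), and recursively: if $t_m(c,r)=+\infty$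 then $t_{m+1}(c,r)=+\infty$; if $t_m(c,r)<+\infty$ then $$t_{m+1}(c,r)=\inf\{t\in[t_m(c,r),1]:x(t)\in(c\mathbb{Z}+r)\setminus\{x(t_m(c,r))\}\}.$$ Quadratic variation along the Lebesgue partition: for $t\in[0,1]$ let $k(c,r,t)=\min\{m\in\mathbb{N}_+:t_m(c,r)\ge t\}$ and $l(c,r,t)=\max\{m\in\mathbb{N}_+:t_m(c,r)\le t\}$. For $0\le s\le t\le1$, $$[x]_{s,t}^{c,r}=\sum_{m=k(c,r,s)}^{l(c,r,t)-1}\bigl(x(t_{m+1}(c,r))-x(t_m(c,r))\bigr)^2,$$ where the sum is $0$ if $l(c,r,t)-1<k(c,r,s)$ or if the set defining $l(c,r,t)$ is empty. Finally $[x]_t^{c,r}:=[x]_{0,t}^{c,r}$. $\lfloor\cdot\rfloor$ denotes the floor function and $\mathbb{N}_+$ the set of positive integers. *)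

theory Defs
  imports Complex_Main "HOL-Library.Extended_Real"
begin

text \<open>Digit sequences are indexed from 1; the value at index 0 is irrelevant.\<close>

definition ternary_expansion :: "(nat \<Rightarrow> nat) \<Rightarrow> real \<Rightarrow> bool" where
  "ternary_expansion d t \<longleftrightarrow>
     (\<forall>j\<ge>1. d j \<in> {0, 1, 2}) \<and> (\<lambda>j. real (d (Suc j)) / 3 ^ Suc j) sums t"

definition kappa :: "nat \<Rightarrow> nat" where
  "kappa d = 2 - d"

definition peano_digit :: "(nat \<Rightarrow> nat) \<Rightarrow> nat \<Rightarrow> nat" where
  "peano_digit d j = (kappa ^^ (\<Sum>i=1..<j. d (2 * i))) (d (2 * j - 1))"

definition peano_series :: "(nat \<Rightarrow> nat) \<Rightarrow> real" where
  "peano_series d = (\<Sum>j. real (peano_digit d (Suc j)) / 3 ^ Suc j)"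

text \<open>The horizontal component of the Peano curve, meaningful on \<open>{0..1}\<close> only. The series
  has the same value for every ternary expansion of \<open>t\<close>, so the choice is immaterial.\<close>

definition peano_x :: "real \<Rightarrow> real" where
  "peano_x t = peano_series (SOME d. ternary_expansion d t)"

definition grid :: "real \<Rightarrow> real \<Rightarrow> real set" where
  "grid c r = {c * real_of_int q + r | q. True}"

text \<open>Lebesgue partition times of the restriction of \<open>x\<close> to \<open>{0..1}\<close>. They are numbered from 1
  (the value at 0 is a dummy), and the infimum of the empty set in \<open>ereal\<close> is \<open>\<infinity>\<close>.\<close>

fun lebesgue_time :: "(real \<Rightarrow> real) \<Rightarrow> real \<Rightarrow> real \<Rightarrow> nat \<Rightarrow> ereal" where
  "lebesgue_time x c r 0 = 0"
| "lebesgue_time x c r (Suc 0) = Inf {ereal t | t. t \<in> {0..1} \<and> x t \<in> grid c r}"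
| "lebesgue_time x c r (Suc (Suc m)) =
    (let T = lebesgue_time x c r (Suc m) in
     if T = \<infinity> then \<infinity>
     else Inf {ereal t | t. t \<in> {real_of_ereal T..1} \<and>
                            x t \<in> grid c r - {x (real_of_ereal T)}})"

definition first_index :: "(real \<Rightarrow> real) \<Rightarrow> real \<Rightarrow> real \<Rightarrow> real \<Rightarrow> nat" where
  "first_index x c r t = (LEAST m. 1 \<le> m \<and> ereal t \<le> lebesgue_time x c r m)"

definition index_set_upto :: "(real \<Rightarrow> real) \<Rightarrow> real \<Rightarrow> real \<Rightarrow> real \<Rightarrow> nat set" where
  "index_set_upto x c r t = {m. 1 \<le> m \<and> lebesgue_time x c r m \<le> ereal t}"

definition last_index :: "(real \<Rightarrow> real) \<Rightarrow> real \<Rightarrow> real \<Rightarrow> real \<Rightarrow> nat" where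
  "last_index x c r t = Max (index_set_upto x c r t)"

text \<open>For continuous \<open>x\<close> and \<open>c > 0\<close> only finitely many partition times are finite, so the minimum
  and, when its set is nonempty, the maximum above exist. Every time occurring in the sum
  is at most \<open>t\<close>, hence finite.\<close>

definition quadratic_variation ::
    "(real \<Rightarrow> real) \<Rightarrow> real \<Rightarrow> real \<Rightarrow> real \<Rightarrow> real \<Rightarrow> real" where
  "quadratic_variation x c r s t =
     (if index_set_upto x c r t = {} then 0
      else \<Sum>m = first_index x c r s..last_index x c r t - 1.
             (x (real_of_ereal (lebesgue_time x c r (m + 1)))
              - x (real_of_ereal (lebesgue_time x c r m)))\<^sup>2)"

end

theory Submission
  imports Defs "HOL-Analysis.Analysis"
begin

text \<open>
  Put \<open>P = 3\<^sup>e p\<close> with \<open>e = \<lfloor>- log\<^sub>3 p\<rfloor>\<close>, so that \<open>1/3 < P \<le> 1\<close>; up to a shift of the index by \<open>e\<close>,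
  the grid has mesh \<open>c = 3\<^sup>-\<^sup>N P\<close>. On a time interval \<open>[k 9\<^sup>-\<^sup>j, (k+1) 9\<^sup>-\<^sup>j]\<close> the curve crosses a
  triadic column of width \<open>3\<^sup>-\<^sup>j\<close>, up or down, by crossing each of its three subcolumns three times
  in alternating directions. The hypothesis on \<open>\<theta>\<close> keeps the grid off the triadic rationals. A column of
  width \<open>3\<^sup>-\<^sup>N\<^sup>-\<^sup>1\<close> contains at most one grid point and one of width \<open>3\<^sup>-\<^sup>N\<close> at least one. So at level
  \<open>N\<close> a crossing passes its grid points in order, a reversal between two crossings
  revisits the same grid point, and a passage to the next column adds one change. If a column of
  width \<open>3\<^sup>m\<^sup>-\<^sup>N\<close> contains \<open>G\<close> grid points, this recursion gives
  \<open>3\<^sup>m G - (3 \<cdot> 9\<^sup>m + 1) / 4\<close> changes per crossing, each contributing \<open>c\<^sup>2\<close>. As \<open>c G\<close> is within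
  \<open>c\<close> of the width, a time interval of length \<open>9\<^sup>-\<^sup>M\<close> contributes \<open>(P - 3/4 P\<^sup>2) 9\<^sup>-\<^sup>M\<close> up to \<open>O(c)\<close>.
  Monotonicity in \<open>t\<close> extends the limit from the times \<open>k 9\<^sup>-\<^sup>M\<close> to all \<open>t\<close>.
\<close>

section \<open>The horizontal component of the Peano curve\<close>

definition ternary :: "(nat \<Rightarrow> nat) \<Rightarrow> bool" where
  "ternary d \<longleftrightarrow> (\<forall>j\<ge>1. d j \<in> {0, 1, 2})"

definition ternary_value :: "(nat \<Rightarrow> nat) \<Rightarrow> real" where
  "ternary_value d = (\<Sum>j. real (d (Suc j)) / 3 ^ Suc j)"

text \<open>One step of the self-similarity uses up two digits: the first selects a column, the
  parity of the second the direction. Indices stay 1-based after the shift.\<close>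

definition drop2 :: "(nat \<Rightarrow> nat) \<Rightarrow> nat \<Rightarrow> nat" where
  "drop2 d j = d (j + 2)"

text \<open>The effect on values of applying \<open>kappa\<close> to all digits; a false flag stands
  for a reversed direction.\<close>

definition flip :: "bool \<Rightarrow> real \<Rightarrow> real" where
  "flip b y = (if b then y else 1 - y)"

lemma flip_in_unit: "y \<in> {0..1} \<Longrightarrow> flip b y \<in> {0..1}"
  by (auto simp: flip_def)

section \<open>Digit series and their recursions\<close>

lemma geometric_third: "(\<lambda>j. 2 / 3 ^ Suc j :: real) sums 1"
proof -
  have "(\<lambda>j. (2/3) * (1/3) ^ j :: real) sums ((2/3) * (1 / (1 - 1/3)))"
    by (intro sums_mult geometric_sums) auto
  then show ?thesis by (simp add: power_divide)
qed

lemma digit_series: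
  assumes "\<And>j. e j \<le> (2::nat)"
  shows "summable (\<lambda>j. real (e j) / 3 ^ Suc j)" and "(\<Sum>j. real (e j) / 3 ^ Suc j) \<in> {0..1}"
proof -
  have le: "real (e j) / 3 ^ Suc j \<le> 2 / 3 ^ Suc j" for j
    using assms[of j] by (intro divide_right_mono) auto
  show s: "summable (\<lambda>j. real (e j) / 3 ^ Suc j)"
    by (rule summable_comparison_test'[OF sums_summable[OF geometric_third], of 0])
      (use le in \<open>auto simp del: power_Suc\<close>)
  have "(\<Sum>j. real (e j) / 3 ^ Suc j) \<le> 1"
    using suminf_le[OF le s sums_summable[OF geometric_third]] sums_unique[OF geometric_third]
    by simp
  moreover have "0 \<le> (\<Sum>j. real (e j) / 3 ^ Suc j)"
    by (intro suminf_nonneg s) auto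
  ultimately show "(\<Sum>j. real (e j) / 3 ^ Suc j) \<in> {0..1}" by simp
qed

lemma ternary_le: "ternary d \<Longrightarrow> d (Suc j) \<le> 2"
  unfolding ternary_def by (drule spec[of _ "Suc j"]) auto

lemma ternary_drop2: "ternary d \<Longrightarrow> ternary (drop2 d)"
  by (auto simp: ternary_def drop2_def)

lemma ternary_expansion_iff:
  "ternary_expansion d t \<longleftrightarrow> ternary d \<and> ternary_value d = t"
proof -
  have "ternary d \<Longrightarrow> (\<lambda>j. real (d (Suc j)) / 3 ^ Suc j) sums ternary_value d"
    unfolding ternary_value_def
    by (rule summable_sums, rule digit_series(1)) (rule ternary_le)
  then show ?thesis
    unfolding ternary_expansion_def ternary_def[symmetric] by (metis sums_unique2)
qed

lemma ternary_value_unit: "ternary d \<Longrightarrow> ternary_value d \<in> {0..1}"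
  unfolding ternary_value_def by (rule digit_series(2)) (rule ternary_le)

lemma ternary_value_step:
  assumes "ternary d"
  shows "ternary_value d = (3 * real (d 1) + real (d 2) + ternary_value (drop2 d)) / 9"
proof -
  have s: "summable (\<lambda>j. real (d (Suc j)) / 3 ^ Suc j)"
    by (rule digit_series(1)) (rule ternary_le[OF assms])
  have s': "summable (\<lambda>j. real (drop2 d (Suc j)) / 3 ^ Suc j)"
    by (rule digit_series(1)) (rule ternary_le[OF ternary_drop2[OF assms]])
  have "ternary_value d = (\<Sum>j. real (d (Suc (j + 2))) / 3 ^ Suc (j + 2))
      + (\<Sum>j<2. real (d (Suc j)) / 3 ^ Suc j)"
    unfolding ternary_value_def by (rule suminf_split_initial_segment[OF s])
  also have "(\<Sum>j. real (d (Suc (j + 2))) / 3 ^ Suc (j + 2))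
      = (\<Sum>j. (real (drop2 d (Suc j)) / 3 ^ Suc j) / 9)"
    by (simp add: drop2_def)
  also have "\<dots> = ternary_value (drop2 d) / 9"
    unfolding ternary_value_def by (rule suminf_divide[OF s'])
  finally show ?thesis by (simp add: numeral_2_eq_2 field_simps)
qed

text \<open>On digits \<open>kappa\<close> is an involution, so only the parity of the exponent
  matters.\<close>

lemma kappa_pow: "e \<le> 2 \<Longrightarrow> (kappa ^^ v) e = (if even v then e else 2 - e)"
  by (induction v) (auto simp: kappa_def)

lemma peano_digit_le:
  assumes "ternary d" shows "peano_digit d (Suc j) \<le> 2"
proof -
  have "d (2 * Suc j - 1) \<le> 2" using ternary_le[OF assms, of "2 * j"] by simp
  then show ?thesis unfolding peano_digit_def by (simp add: kappa_pow)
qed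

lemma peano_digit_first: "peano_digit d (Suc 0) = d 1"
  by (simp add: peano_digit_def)

text \<open>The exponent is \<open>d 2\<close> plus the exponent belonging to the shifted sequence,
  so the same power of \<open>kappa\<close> is applied to all later digits.\<close>

lemma peano_digit_Suc:
  assumes "ternary d"
  shows "real (peano_digit d (Suc (Suc j)))
    = (if even (d 2) then real (peano_digit (drop2 d) (Suc j))
       else 2 - real (peano_digit (drop2 d) (Suc j)))"
proof -
  have eq: "(\<Sum>i=1..<Suc (Suc j). d (2 * i)) = d 2 + (\<Sum>i=1..<Suc j. drop2 d (2 * i))"
    by (simp add: sum.atLeast_Suc_lessThan sum.shift_bounds_Suc_ivl drop2_def numeral_2_eq_2
        del: sum.op_ivl_Suc)
  have "peano_digit d (Suc (Suc j)) = (kappa ^^ d 2) (peano_digit (drop2 d) (Suc j))"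
    unfolding peano_digit_def eq funpow_add by (simp add: drop2_def)
  then show ?thesis
    using peano_digit_le[OF ternary_drop2[OF assms], of j] by (simp add: kappa_pow of_nat_diff)
qed

lemma peano_series_unit: "ternary d \<Longrightarrow> peano_series d \<in> {0..1}"
  unfolding peano_series_def by (rule digit_series(2)) (rule peano_digit_le)

text \<open>For odd \<open>d 2\<close> all later digits are complemented. As the series of
  \<open>2 / 3 ^ Suc j\<close> sums to 1, this turns the remaining value \<open>y\<close> into
  \<open>1 - y\<close>.\<close>

lemma peano_series_step:
  assumes "ternary d"
  shows "peano_series d = (real (d 1) + flip (even (d 2)) (peano_series (drop2 d))) / 3"
proof -
  have s: "summable (\<lambda>j. real (peano_digit d (Suc j)) / 3 ^ Suc j)"
    by (rule digit_series(1)) (rule peano_digit_le[OF assms])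
  let ?e = "\<lambda>j. real (peano_digit (drop2 d) (Suc j)) / 3 ^ Suc j"
  have s': "summable ?e"
    by (rule digit_series(1)) (rule peano_digit_le[OF ternary_drop2[OF assms]])
  have "peano_series d = (\<Sum>j. real (peano_digit d (Suc (j + 1))) / 3 ^ Suc (j + 1))
      + (\<Sum>j<1. real (peano_digit d (Suc j)) / 3 ^ Suc j)"
    unfolding peano_series_def by (rule suminf_split_initial_segment[OF s])
  also have "(\<Sum>j. real (peano_digit d (Suc (j + 1))) / 3 ^ Suc (j + 1))
     = flip (even (d 2)) (peano_series (drop2 d)) / 3"
  proof (cases "even (d 2)")
    case True
    then show ?thesis
      using suminf_divide[OF s', of 3] peano_digit_Suc[OF assms]
      by (simp add: flip_def peano_series_def mult.commute)
  next
    case False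
    have "(\<lambda>j. (2 / 3 ^ Suc j - ?e j) / 3) sums ((1 - peano_series (drop2 d)) / 3)"
      unfolding peano_series_def
      by (intro sums_divide sums_diff geometric_third summable_sums s')
    moreover have "(2 / 3 ^ Suc j - ?e j) / 3
        = real (peano_digit d (Suc (j + 1))) / 3 ^ Suc (j + 1)" for j
      using False peano_digit_Suc[OF assms, of j] by (simp add: field_simps)
    ultimately show ?thesis
      using False by (simp add: flip_def sums_iff)
  qed
  finally show ?thesis by (simp add: peano_digit_first field_simps)
qed

section \<open>Independence of the choice of expansion\<close>

text \<open>Serves a contraction argument: removing two digits divides the discrepancy by 3, so
  induction on \<open>n\<close> yields the bound \<open>(1/3) ^ n\<close>.\<close>

lemma eq_if_abs_diff_le_third_power:
  fixes a b :: real
  assumes "\<And>n. \<bar>a - b\<bar> \<le> (1/3) ^ n"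
  shows "a = b"
proof (rule ccontr)
  assume "a \<noteq> b"
  then obtain n where "(1/3::real) ^ n < \<bar>a - b\<bar>"
    using real_arch_pow_inv[of "\<bar>a - b\<bar>" "1/3"] by auto
  with assms[of n] show False by simp
qed

lemma ternary_first_cases:
  assumes "ternary d"
  shows "d 1 \<in> {0, 1, 2}" "d 2 \<in> {0, 1, 2}"
  using assms by (auto simp: ternary_def)

text \<open>Value 0 forces both leading digits and the remaining value to be 0, so the claim
  reproduces itself with factor 1/3.\<close>

lemma peano_series_value_0:
  assumes "ternary d" "ternary_value d = 0"
  shows "peano_series d = 0"
proof (rule eq_if_abs_diff_le_third_power)
  show "\<bar>peano_series d - 0\<bar> \<le> (1/3) ^ n" for n
    using assms
  proof (induction n arbitrary: d)
    case 0
    then show ?case using peano_series_unit[of d] by simp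
  next
    case (Suc n)
    have "a = 0 \<and> b = 0 \<and> c = 0"
      if "(3 * a + b + c) / 9 = 0" "0 \<le> a" "0 \<le> b" "0 \<le> c" for a b c :: real
      using that by auto
    from this[of "real (d 1)" "real (d 2)" "ternary_value (drop2 d)"]
    have *: "real (d 1) = 0" "real (d 2) = 0" "ternary_value (drop2 d) = 0"
      using ternary_value_step[OF Suc.prems(1)] Suc.prems(2)
        ternary_value_unit[OF ternary_drop2[OF Suc.prems(1)]] by simp_all
    from Suc.IH[OF ternary_drop2[OF Suc.prems(1)] *(3)] show ?case
      using peano_series_step[OF Suc.prems(1)] * by (simp add: flip_def)
  qed
qed

lemma peano_series_value_1:
  assumes "ternary d" "ternary_value d = 1"
  shows "peano_series d = 1"
proof (rule eq_if_abs_diff_le_third_power)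
  show "\<bar>peano_series d - 1\<bar> \<le> (1/3) ^ n" for n
    using assms
  proof (induction n arbitrary: d)
    case 0
    then show ?case using peano_series_unit[of d] by simp
  next
    case (Suc n)
    have "a = 2 \<and> b = 2 \<and> c = 1"
      if "(3 * a + b + c) / 9 = 1" "a \<le> 2" "b \<le> 2" "c \<le> 1" for a b c :: real
      using that by (auto simp: field_simps)
    from this[of "real (d 1)" "real (d 2)" "ternary_value (drop2 d)"]
    have *: "real (d 1) = 2" "real (d 2) = 2" "ternary_value (drop2 d) = 1"
      using ternary_value_step[OF Suc.prems(1)] Suc.prems(2) ternary_first_cases[OF Suc.prems(1)]
        ternary_value_unit[OF ternary_drop2[OF Suc.prems(1)]] by auto
    from Suc.IH[OF ternary_drop2[OF Suc.prems(1)] *(3)] show ?case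
      unfolding peano_series_step[OF Suc.prems(1)] using *
      by (simp add: flip_def abs_le_iff field_simps)
  qed
qed

text \<open>Equal values with different leading pairs force the numbers \<open>3 * d 1 + d 2\<close>
  to be consecutive, with remainder 1 on the smaller side and 0 on the larger. In each of the three
  possible carries the directions are such that the end points meet.\<close>

lemma peano_series_cong_aux:
  assumes d: "ternary d" and d': "ternary d'" and eq: "ternary_value d = ternary_value d'"
    and less: "3 * d 1 + d 2 < 3 * d' 1 + d' 2"
  shows "peano_series d = peano_series d'"
proof -
  have v: "3 * real (d 1) + real (d 2) + ternary_value (drop2 d)
     = 3 * real (d' 1) + real (d' 2) + ternary_value (drop2 d')"
    using eq ternary_value_step[OF d] ternary_value_step[OF d'] by simp
  have "real (3 * d 1 + d 2) + 1 \<le> real (3 * d' 1 + d' 2)" using less by linarith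
  then have *: "ternary_value (drop2 d) = 1" "ternary_value (drop2 d') = 0"
    and step: "real (3 * d 1 + d 2) + 1 = real (3 * d' 1 + d' 2)"
    using v ternary_value_unit[OF ternary_drop2[OF d]] ternary_value_unit[OF ternary_drop2[OF d']]
    by auto
  have "3 * d 1 + d 2 + 1 = 3 * d' 1 + d' 2" using step by linarith
  moreover have "d 1 \<in> {0, 1, 2}" "d 2 \<in> {0, 1, 2}" "d' 1 \<in> {0, 1, 2}" "d' 2 \<in> {0, 1, 2}"
    using ternary_first_cases[OF d] ternary_first_cases[OF d'] by auto
  ultimately consider "d 1 = d' 1" "d 2 = 0" "d' 2 = 1" | "d 1 = d' 1" "d 2 = 1" "d' 2 = 2"
    | "d' 1 = d 1 + 1" "d 2 = 2" "d' 2 = 0"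
    by auto
  then show ?thesis
    unfolding peano_series_step[OF d] peano_series_step[OF d']
      peano_series_value_1[OF ternary_drop2[OF d] *(1)]
      peano_series_value_0[OF ternary_drop2[OF d'] *(2)]
    by cases (simp_all add: flip_def)
qed

lemma peano_series_cong:
  assumes "ternary d" "ternary d'" "ternary_value d = ternary_value d'"
  shows "peano_series d = peano_series d'"
proof (rule eq_if_abs_diff_le_third_power)
  show "\<bar>peano_series d - peano_series d'\<bar> \<le> (1/3) ^ n" for n
    using assms
  proof (induction n arbitrary: d d')
    case 0
    then show ?case using peano_series_unit[of d] peano_series_unit[of d'] by auto
  next
    case (Suc n)
    show ?case
    proof (cases "3 * d 1 + d 2 = 3 * d' 1 + d' 2")
      case True
      moreover have "d 1 \<in> {0, 1, 2}" "d 2 \<in> {0, 1, 2}" "d' 1 \<in> {0, 1, 2}" "d' 2 \<in> {0, 1, 2}"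
        using ternary_first_cases[OF Suc.prems(1)] ternary_first_cases[OF Suc.prems(2)] by auto
      ultimately have *: "d 1 = d' 1" "d 2 = d' 2" by auto
      then have "ternary_value (drop2 d) = ternary_value (drop2 d')"
        using Suc.prems(3) ternary_value_step[OF Suc.prems(1)] ternary_value_step[OF Suc.prems(2)]
        by simp
      from Suc.IH[OF ternary_drop2[OF Suc.prems(1)] ternary_drop2[OF Suc.prems(2)] this]
      show ?thesis
        using * peano_series_step[OF Suc.prems(1)] peano_series_step[OF Suc.prems(2)]
        by (auto simp: flip_def abs_if split: if_splits)
    next
      case False
      then have "peano_series d = peano_series d'"
        using peano_series_cong_aux Suc.prems by (metis linorder_neqE_nat)
      then show ?thesis by simp
    qed
  qed
qed

section \<open>Existence of expansions\<close>

lemma ternary_expansion_exists: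
  assumes "t \<in> {0..1}" shows "\<exists>d. ternary_expansion d t"
proof (cases "t = 1")
  case True
  then have "ternary_expansion (\<lambda>_. 2) t"
    using geometric_third by (simp add: ternary_expansion_def)
  then show ?thesis by blast
next
  case False
  with assms have t: "0 \<le> t" "t < 1" by auto
  \<comment> \<open>Greedy digits, with partial sums
    \<open>\<lfloor>3 ^ n * t\<rfloor> / 3 ^ n\<close>. The case \<open>n = 0\<close> needs
    \<open>\<lfloor>t\<rfloor> = 0\<close>, which is why \<open>t = 1\<close> is treated
    apart.\<close>
  define d where "d j = nat (\<lfloor>3 ^ j * t\<rfloor> mod 3)" for j
  have part: "(\<Sum>j<n. real (d (Suc j)) / 3 ^ Suc j) = of_int \<lfloor>3 ^ n * t\<rfloor> / 3 ^ n" for n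
  proof (induction n)
    case 0
    then show ?case using t by (simp add: floor_unique)
  next
    case (Suc n)
    have "\<lfloor>3 ^ Suc n * t\<rfloor> div 3 = \<lfloor>3 ^ n * t\<rfloor>"
      using floor_divide_of_int_eq[of "\<lfloor>3 ^ Suc n * t\<rfloor>" 3] floor_divide_real_eq_div[of 3 "3 ^ Suc n * t"] by simp
    then have "\<lfloor>3 ^ Suc n * t\<rfloor> = 3 * \<lfloor>3 ^ n * t\<rfloor> + int (d (Suc n))"
      unfolding d_def using mult_div_mod_eq[of 3 "\<lfloor>3 ^ Suc n * t\<rfloor>"] by simp
    then have "(of_int \<lfloor>3 ^ Suc n * t\<rfloor> :: real) = 3 * of_int \<lfloor>3 ^ n * t\<rfloor> + real (d (Suc n))"
      by simp
    with Suc show ?case by (simp add: field_simps)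
  qed
  have "(\<lambda>n. t - (1/3) ^ n) \<longlonglongrightarrow> t - 0" by (intro tendsto_intros LIMSEQ_power_zero) auto
  then have lim: "(\<lambda>n. t - (1/3) ^ n) \<longlonglongrightarrow> t" by simp
  have "(\<lambda>n. of_int \<lfloor>3 ^ n * t\<rfloor> / 3 ^ n) \<longlonglongrightarrow> t"
  proof (rule tendsto_sandwich[OF _ _ lim tendsto_const])
    have "t - (1/3) ^ n \<le> of_int \<lfloor>3 ^ n * t\<rfloor> / 3 ^ n" for n
    proof -
      have "(3 ^ n * t - 1) / 3 ^ n \<le> of_int \<lfloor>3 ^ n * t\<rfloor> / 3 ^ n"
        by (intro divide_right_mono zero_le_power) linarith+
      then show ?thesis by (simp add: field_simps)
    qed
    then show "\<forall>\<^sub>F n in sequentially. t - (1/3) ^ n \<le> of_int \<lfloor>3 ^ n * t\<rfloor> / 3 ^ n" by simp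
    have "of_int \<lfloor>3 ^ n * t\<rfloor> / 3 ^ n \<le> t" for n
      by (simp add: divide_le_eq mult.commute)
    then show "\<forall>\<^sub>F n in sequentially. of_int \<lfloor>3 ^ n * t\<rfloor> / 3 ^ n \<le> t" by simp
  qed
  then have "(\<lambda>j. real (d (Suc j)) / 3 ^ Suc j) sums t" unfolding sums_def part .
  moreover have "d j \<in> {0, 1, 2}" for j
  proof -
    have "0 \<le> \<lfloor>3 ^ j * t\<rfloor> mod 3" "\<lfloor>3 ^ j * t\<rfloor> mod 3 < 3" by simp_all
    then show ?thesis unfolding d_def by auto
  qed
  ultimately have "ternary_expansion d t" unfolding ternary_expansion_def by blast
  then show ?thesis by blast
qed

lemma peano_x_eq:
  assumes "ternary_expansion d t" shows "peano_x t = peano_series d"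
  unfolding peano_x_def
proof (rule someI2[of _ d])
  show "ternary_expansion e t \<Longrightarrow> peano_series e = peano_series d" for e
    using assms peano_series_cong[of e d] by (simp add: ternary_expansion_iff)
qed fact

lemma peano_x_unit:
  assumes "t \<in> {0..1}" shows "peano_x t \<in> {0..1}"
  using ternary_expansion_exists[OF assms] peano_x_eq peano_series_unit
  by (metis ternary_expansion_iff)

lemma peano_x_0: "peano_x 0 = 0" and peano_x_1: "peano_x 1 = 1"
  using ternary_expansion_exists[of 0] ternary_expansion_exists[of 1] peano_x_eq
    peano_series_value_0 peano_series_value_1
  by (metis ternary_expansion_iff atLeastAtMost_iff order_refl zero_le_one)+

section \<open>Self-similarity, triadic columns and continuity\<close>

text \<open>Putting the digits \<open>u\<close>, \<open>v\<close> in front of an expansion of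
  \<open>s\<close> transfers the recursion from digit series to the curve.\<close>

lemma peano_x_step:
  assumes "u \<le> 2" "v \<le> 2" "s \<in> {0..1}"
  shows "peano_x ((3 * real u + real v + s) / 9) = (real u + flip (even v) (peano_x s)) / 3"
proof -
  obtain e where e: "ternary_expansion e s" using ternary_expansion_exists assms(3) by blast
  define d where "d j = (if j = 1 then u else if j = 2 then v else e (j - 2))" for j
  have t: "ternary d"
    unfolding ternary_def
  proof (intro allI impI)
    fix j :: nat assume "1 \<le> j"
    then consider "j = 1" | "j = 2" | "1 \<le> j - 2" by linarith
    then show "d j \<in> {0, 1, 2}"
      using assms(1,2) e unfolding ternary_expansion_def d_def by cases auto
  qed
  have shift: "drop2 d j = e j" if "j \<ge> 1" for j using that by (simp add: drop2_def d_def)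
  have val: "ternary_value (drop2 d) = s"
    using e shift unfolding ternary_expansion_iff ternary_value_def by simp
  then have "ternary_expansion d ((3 * real u + real v + s) / 9)"
    using t ternary_value_step[OF t] by (simp add: ternary_expansion_iff d_def)
  then have "peano_x ((3 * real u + real v + s) / 9) = peano_series d" by (rule peano_x_eq)
  moreover have "peano_x s = peano_series (drop2 d)"
    by (rule peano_x_eq) (simp add: ternary_expansion_iff ternary_drop2 t val)
  ultimately show ?thesis using peano_series_step[OF t] by (simp add: d_def)
qed

text \<open>On a time interval of length \<open>9\<^sup>-\<^sup>j\<close> starting at \<open>a\<close>, the curve crosses the triadic
  column \<open>i\<close> of width \<open>3\<^sup>-\<^sup>j\<close>, upwards iff \<open>up\<close>.\<close>

definition peano_block :: "nat \<Rightarrow> real \<Rightarrow> nat \<Rightarrow> bool \<Rightarrow> bool" where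
  "peano_block j a i up \<longleftrightarrow> 0 \<le> a \<and> a + 1 / 9 ^ j \<le> 1 \<and>
     (\<forall>s\<in>{0..1}. peano_x (a + s / 9 ^ j) = (real i + flip up (peano_x s)) / 3 ^ j)"

lemma peano_block_0: "peano_block 0 0 0 True"
  by (simp add: peano_block_def flip_def)

text \<open>\<open>u\<close> numbers the subcolumns in the order of passage, hence the reflection
  \<open>2 - u\<close> when going down; \<open>v\<close> numbers the three crossings of one
  subcolumn, the middle one being reversed.\<close>

lemma peano_block_sub:
  assumes "peano_block j a i up" "u \<le> 2" "v \<le> 2"
  shows "peano_block (Suc j) (a + real (3 * u + v) / 9 ^ Suc j)
    (3 * i + (if up then u else 2 - u)) (up = even v)"
proof -
  have "a + (real (3 * u + v) / 9 ^ Suc j + 1 / 9 ^ Suc j) \<le> a + 1 / 9 ^ j"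
  proof -
    have "real (3 * u + v) + 1 \<le> 9" using assms(2,3) by simp
    then have "(real (3 * u + v) + 1) / 9 ^ Suc j \<le> 9 / 9 ^ Suc j" by (rule divide_right_mono) simp
    then show ?thesis by (simp add: add_divide_distrib)
  qed
  then have "a + real (3 * u + v) / 9 ^ Suc j + 1 / 9 ^ Suc j \<le> 1"
    using assms(1) unfolding peano_block_def by linarith
  moreover have "peano_x (a + real (3 * u + v) / 9 ^ Suc j + s / 9 ^ Suc j)
      = (real (3 * i + (if up then u else 2 - u)) + flip (up = even v) (peano_x s)) / 3 ^ Suc j"
    if s: "s \<in> {0..1}" for s
  proof -
    have "(3 * real u + real v + s) / 9 \<in> {0..1}" using s assms(2,3) by auto
    then have "peano_x (a + (3 * real u + real v + s) / 9 / 9 ^ j)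
        = (real i + flip up (peano_x ((3 * real u + real v + s) / 9))) / 3 ^ j"
      using assms(1) unfolding peano_block_def by blast
    also note peano_x_step[OF assms(2,3) s]
    finally have "peano_x (a + (3 * real u + real v + s) / 9 / 9 ^ j)
        = (real i + flip up ((real u + flip (even v) (peano_x s)) / 3)) / 3 ^ j" .
    moreover have "a + (3 * real u + real v + s) / 9 / 9 ^ j
        = a + real (3 * u + v) / 9 ^ Suc j + s / 9 ^ Suc j"
      by (simp add: field_simps)
    ultimately show ?thesis
      using assms(2) by (auto simp: flip_def field_simps of_nat_diff)
  qed
  ultimately show ?thesis using assms(1) unfolding peano_block_def by auto
qed

lemma peano_block_exists:
  "k < 9 ^ j \<Longrightarrow> \<exists>i up. peano_block j (real k / 9 ^ j) i up"
proof (induction j arbitrary: k)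
  case 0
  then show ?case using peano_block_0 by auto
next
  case (Suc j)
  obtain i up where b: "peano_block j (real (k div 9) / 9 ^ j) i up"
    using Suc.IH[of "k div 9"] Suc.prems by (auto simp: less_mult_imp_div_less mult.commute)
  \<comment> \<open>\<open>3 * u + v\<close> is the last base-9 digit of \<open>k\<close>, and
    \<open>k div 9\<close> indexes the parent block.\<close>
  define u where "u = k div 3 mod 3"
  define v where "v = k mod 3"
  have uv: "u \<le> 2" "v \<le> 2" unfolding u_def v_def by simp_all
  have "k = 3 * (k div 3) + v" "k div 3 = 3 * (k div 3 div 3) + u"
    unfolding u_def v_def by simp_all
  moreover have "k div 3 div 3 = k div 9" by (simp flip: div_mult2_eq)
  ultimately have k: "k = 9 * (k div 9) + (3 * u + v)" by linarith
  have "real k = 9 * real (k div 9) + real (3 * u + v)" using k by linarith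
  then have "real (k div 9) / 9 ^ j + real (3 * u + v) / 9 ^ Suc j = real k / 9 ^ Suc j"
    by (simp add: field_simps)
  then show ?case using peano_block_sub[OF b uv] by auto
qed

lemma peano_block_bounds:
  assumes "peano_block j a i up" "t \<in> {a..a + 1 / 9 ^ j}"
  shows "peano_x t \<in> {real i / 3 ^ j..real (Suc i) / 3 ^ j}"
proof -
  have s: "(t - a) * 9 ^ j \<in> {0..1}" using assms(2) by (auto simp: field_simps)
  then have "peano_x t = (real i + flip up (peano_x ((t - a) * 9 ^ j))) / 3 ^ j"
    using assms(1) unfolding peano_block_def by force
  moreover have "flip up (peano_x ((t - a) * 9 ^ j)) \<in> {0..1}"
    by (intro flip_in_unit peano_x_unit s)
  ultimately show ?thesis by (auto simp: divide_right_mono)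
qed

text \<open>The time \<open>t\<close> lies in the block of \<open>s\<close> or in the next one, and
  on each block the curve stays in a column of width \<open>1 / 3 ^ j\<close>.\<close>

lemma peano_x_close_aux:
  assumes "0 \<le> s" "s \<le> t" "t \<le> 1" "t - s < 1 / 9 ^ j"
  shows "\<bar>peano_x t - peano_x s\<bar> \<le> 2 / 3 ^ j"
proof (cases "s = 1")
  case True
  then show ?thesis using assms by auto
next
  case False
  define k where "k = nat \<lfloor>9 ^ j * s\<rfloor>"
  have k: "real k \<le> 9 ^ j * s" "9 ^ j * s < real k + 1" unfolding k_def using assms(1) by (simp, simp)
  have "9 ^ j * s < 9 ^ j" using False assms by simp
  then have "real k < 9 ^ j" using k by linarith
  then have "k < 9 ^ j" by (metis of_nat_less_iff of_nat_numeral of_nat_power)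
  then obtain i up where b: "peano_block j (real k / 9 ^ j) i up" using peano_block_exists by blast
  have s_in: "s \<in> {real k / 9 ^ j..real k / 9 ^ j + 1 / 9 ^ j}"
    using k by (auto simp: field_simps)
  have one: "\<bar>a - b\<bar> \<le> 1 / 3 ^ j" if "a \<in> {real i / 3 ^ j..real (Suc i) / 3 ^ j}"
      "b \<in> {real i / 3 ^ j..real (Suc i) / 3 ^ j}" for a b i
    using that by (auto simp: abs_le_iff add_divide_distrib)
  show ?thesis
  proof (cases "t \<le> real k / 9 ^ j + 1 / 9 ^ j")
    case True
    then have "t \<in> {real k / 9 ^ j..real k / 9 ^ j + 1 / 9 ^ j}" using s_in assms(2) by auto
    from one[OF peano_block_bounds[OF b this] peano_block_bounds[OF b s_in]]
    have "\<bar>peano_x t - peano_x s\<bar> \<le> 1 / 3 ^ j" .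
    also have "\<dots> \<le> 2 / 3 ^ j" by (simp add: divide_right_mono)
    finally show ?thesis .
  next
    case f: False
    define m where "m = real k / 9 ^ j + 1 / 9 ^ j"
    have m: "m = real (Suc k) / 9 ^ j" by (simp add: m_def field_simps)
    have "m < 1" using f assms(3) unfolding m_def by linarith
    then have "real (Suc k) < 9 ^ j" by (simp add: m)
    then have "Suc k < 9 ^ j" by (metis of_nat_less_iff of_nat_numeral of_nat_power)
    then obtain i' up' where b': "peano_block j m i' up'"
      using peano_block_exists unfolding m by blast
    have "m \<in> {real k / 9 ^ j..real k / 9 ^ j + 1 / 9 ^ j}" by (simp add: m_def)
    from one[OF peano_block_bounds[OF b this] peano_block_bounds[OF b s_in]]
    have 1: "\<bar>peano_x m - peano_x s\<bar> \<le> 1 / 3 ^ j" .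
    have "t \<in> {m..m + 1 / 9 ^ j}" "m \<in> {m..m + 1 / 9 ^ j}"
      using f s_in assms(4) by (auto simp: m_def)
    from one[OF peano_block_bounds[OF b' this(1)] peano_block_bounds[OF b' this(2)]]
    have "\<bar>peano_x t - peano_x m\<bar> \<le> 1 / 3 ^ j" .
    moreover have "2 / 3 ^ j = 1 / 3 ^ j + 1 / (3::real) ^ j" by simp
    ultimately show ?thesis using 1 by linarith
  qed
qed

lemma peano_x_close:
  assumes "s \<in> {0..1}" "t \<in> {0..1}" "\<bar>t - s\<bar> < 1 / 9 ^ j"
  shows "\<bar>peano_x t - peano_x s\<bar> \<le> 2 / 3 ^ j"
  using peano_x_close_aux[of s t j] peano_x_close_aux[of t s j] assms
  by (cases "s \<le> t") (auto simp: abs_minus_commute)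

lemma continuous_on_peano_x: "continuous_on {0..1} peano_x"
  unfolding continuous_on_iff
proof (intro ballI allI impI)
  fix s e :: real assume s: "s \<in> {0..1}" and "e > 0"
  then obtain j where "(1/3::real) ^ j < e / 2"
    using real_arch_pow_inv[of "e / 2" "1/3"] by auto
  then have j: "2 / 3 ^ j < e" by (simp add: field_simps)
  show "\<exists>\<delta>>0. \<forall>t\<in>{0..1}. dist t s < \<delta> \<longrightarrow> dist (peano_x t) (peano_x s) < e"
    using peano_x_close[OF s] j
    by (intro exI[of _ "1 / 9 ^ j"]) (fastforce simp: dist_real_def)
qed

text \<open>The rescaled curve runs from 0 to 1, so the intermediate value theorem applies;
  \<open>flip up\<close> is its own inverse.\<close>

lemma peano_block_surj:
  assumes b: "peano_block j a i up" and y: "y \<in> {real i / 3 ^ j..real (Suc i) / 3 ^ j}"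
  shows "\<exists>t\<in>{a..a + 1 / 9 ^ j}. peano_x t = y"
proof -
  have "flip up (3 ^ j * y - real i) \<in> {0..1}"
    using y by (intro flip_in_unit) (auto simp: field_simps)
  then obtain s where s: "0 \<le> s" "s \<le> 1" "peano_x s = flip up (3 ^ j * y - real i)"
    using IVT'[of peano_x 0 "flip up (3 ^ j * y - real i)" 1]
    by (auto simp: peano_x_0 peano_x_1 continuous_on_peano_x)
  then have "peano_x (a + s / 9 ^ j) = y"
    using b unfolding peano_block_def by (auto simp: flip_def)
  moreover have "a + s / 9 ^ j \<in> {a..a + 1 / 9 ^ j}" using s by (simp add: divide_right_mono)
  ultimately show ?thesis by blast
qed

section \<open>Lebesgue partitions\<close>

text \<open>An affine image of a set of integers is closed. This is applied to the grid without its
  current point.\<close>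

lemma closed_subset_grid:
  assumes "c > 0" "B \<subseteq> grid c r" shows "closed B"
proof -
  have "B = (+) r ` (\<lambda>y. c *\<^sub>R y) ` of_int ` {q. c * real_of_int q + r \<in> B}"
    using assms(2) unfolding grid_def image_image by (force simp: add.commute)
  moreover have "closed ((+) r ` (\<lambda>y. c *\<^sub>R y) ` of_int ` {q. c * real_of_int q + r \<in> B})"
    by (intro closed_translation closed_scaling closed_of_int_image)
  ultimately show ?thesis by metis
qed

text \<open>By compactness the infimum is attained unless the set is empty, so a finite infimum is a
  genuine first hit.\<close>

lemma Inf_hitting_times:
  fixes x :: "real \<Rightarrow> real"
  assumes "continuous_on {0..1} x" "closed B" "0 \<le> a"
  obtains "Inf {ereal t |t. t \<in> {a..1} \<and> x t \<in> B} = \<infinity>" "\<And>t. t \<in> {a..1} \<Longrightarrow> x t \<notin> B"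
  | v where "Inf {ereal t |t. t \<in> {a..1} \<and> x t \<in> B} = ereal v" "v \<in> {a..1}" "x v \<in> B"
      "\<And>t. t \<in> {a..<v} \<Longrightarrow> x t \<notin> B"
proof (cases "{t \<in> {a..1}. x t \<in> B} = {}")
  case True
  then have "{ereal t |t. t \<in> {a..1} \<and> x t \<in> B} = {}" by auto
  then have "Inf {ereal t |t. t \<in> {a..1} \<and> x t \<in> B} = \<infinity>"
    by (simp only: Inf_empty top_ereal_def)
  then show ?thesis using True that(1) by blast
next
  case False
  have "continuous_on {a..1} x" using assms(1,3) by (auto elim: continuous_on_subset)
  then have "closed ({a..1} \<inter> x -` B)" using assms(2) by (simp add: continuous_closed_preimage)
  then have "compact ({a..1} \<inter> ({a..1} \<inter> x -` B))" by (intro compact_Int_closed compact_Icc)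
  then have "compact {t \<in> {a..1}. x t \<in> B}" by (simp add: Int_def vimage_def conj_ac)
  then obtain v where v: "v \<in> {t \<in> {a..1}. x t \<in> B}" "\<forall>t \<in> {t \<in> {a..1}. x t \<in> B}. v \<le> t"
    using compact_attains_inf[of "{t \<in> {a..1}. x t \<in> B}"] False by blast
  have "Inf {ereal t |t. t \<in> {a..1} \<and> x t \<in> B} = ereal v"
    by (rule antisym[OF Inf_lower Inf_greatest]) (use v in auto)
  moreover have "x t \<notin> B" if "t \<in> {a..<v}" for t
  proof
    assume "x t \<in> B"
    then have "v \<le> t" using v that by auto
    then show False using that by auto
  qed
  ultimately show ?thesis using that(2) v(1) by blast
qed

text \<open>\<open>partition_state t l s\<close>: exactly \<open>l\<close> partition times are at most \<open>t\<close>, and \<open>s\<close> is the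
  grid point attained at the last of them.\<close>

definition partition_state ::
    "(real \<Rightarrow> real) \<Rightarrow> real \<Rightarrow> real \<Rightarrow> real \<Rightarrow> nat \<Rightarrow> real option \<Rightarrow> bool" where
  "partition_state x c r t l s \<longleftrightarrow> ereal t < lebesgue_time x c r (Suc l) \<and>
     (if l = 0 then s = None
      else lebesgue_time x c r l \<le> ereal t \<and> s = Some (x (real_of_ereal (lebesgue_time x c r l))))"

locale lebesgue_partition =
  fixes x :: "real \<Rightarrow> real" and c r :: real
  assumes cont: "continuous_on {0..1} x" and c_pos: "c > 0"
begin

abbreviation "T \<equiv> lebesgue_time x c r"
abbreviation "state \<equiv> partition_state x c r"

lemma closed_grid_diff: "closed (grid c r - S)"
  by (rule closed_subset_grid[OF c_pos]) auto

lemma time_Suc_Suc: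
  "T (Suc m) = ereal \<tau> \<Longrightarrow>
   T (Suc (Suc m)) = Inf {ereal t |t. t \<in> {\<tau>..1} \<and> x t \<in> grid c r - {x \<tau>}}"
  by (simp add: Let_def)

lemma time_Suc_cases:
  obtains "T (Suc m) = \<infinity>"
  | \<tau> where "T (Suc m) = ereal \<tau>" "\<tau> \<in> {0..1}" "x \<tau> \<in> grid c r"
proof (induction m arbitrary: thesis)
  case 0
  have "closed (grid c r)" using closed_grid_diff[of "{}"] by simp
  then show ?case
    by (rule Inf_hitting_times[OF cont, of _ 0]) (use 0 in \<open>auto\<close>)
next
  case (Suc m)
  show ?case
  proof (rule Suc.IH)
    assume "T (Suc m) = \<infinity>"
    then show ?thesis using Suc.prems(1) by (simp add: Let_def)
  next
    fix \<tau> assume \<tau>: "T (Suc m) = ereal \<tau>" "\<tau> \<in> {0..1}"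
    show ?thesis
      by (rule Inf_hitting_times[OF cont closed_grid_diff, of \<tau> "{x \<tau>}"])
        (use Suc.prems \<tau>(2) time_Suc_Suc[OF \<tau>(1)] in \<open>auto\<close>)
  qed
qed

lemma time_nonneg: "0 \<le> T (Suc m)"
  by (rule time_Suc_cases[of m]) auto

lemma time_Suc_Suc_cases:
  obtains "T (Suc (Suc m)) = \<infinity>"
  | \<tau> \<sigma> where "T (Suc m) = ereal \<tau>" "T (Suc (Suc m)) = ereal \<sigma>" "0 \<le> \<tau>" "\<tau> \<le> \<sigma>" "\<sigma> \<le> 1"
      "x \<tau> \<in> grid c r" "x \<sigma> \<in> grid c r" "x \<sigma> \<noteq> x \<tau>"
      "\<And>t. t \<in> {\<tau>..<\<sigma>} \<Longrightarrow> x t \<in> grid c r \<Longrightarrow> x t = x \<tau>"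
proof (rule time_Suc_cases[of m])
  assume "T (Suc m) = \<infinity>"
  then show ?thesis using that(1) by (simp add: Let_def)
next
  fix \<tau> assume \<tau>: "T (Suc m) = ereal \<tau>" "\<tau> \<in> {0..1}" "x \<tau> \<in> grid c r"
  show ?thesis
  proof (rule Inf_hitting_times[OF cont closed_grid_diff, of \<tau> "{x \<tau>}"])
    show "0 \<le> \<tau>" using \<tau> by simp
  next
    assume "Inf {ereal t |t. t \<in> {\<tau>..1} \<and> x t \<in> grid c r - {x \<tau>}} = \<infinity>"
    then show ?thesis using that(1) time_Suc_Suc[OF \<tau>(1)] by simp
  next
    fix \<sigma> assume "Inf {ereal t |t. t \<in> {\<tau>..1} \<and> x t \<in> grid c r - {x \<tau>}} = ereal \<sigma>"
      "\<sigma> \<in> {\<tau>..1}" "x \<sigma> \<in> grid c r - {x \<tau>}" "\<And>t. t \<in> {\<tau>..<\<sigma>} \<Longrightarrow> x t \<notin> grid c r - {x \<tau>}"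
    then show ?thesis using that(2)[of \<tau> \<sigma>] time_Suc_Suc[OF \<tau>(1)] \<tau> by auto
  qed
qed

lemma time_mono: "m \<le> n \<Longrightarrow> T (Suc m) \<le> T (Suc n)"
proof (induction n rule: dec_induct)
  case (step n)
  have "T (Suc n) \<le> T (Suc (Suc n))"
    by (rule time_Suc_Suc_cases[of n]) auto
  with step show ?case by order
qed simp

text \<open>A jump of more than one grid step would pass, by the intermediate value theorem, through
  a grid point that ends the waiting time earlier.\<close>

lemma partition_step:
  assumes "T (Suc m) = ereal \<tau>" "T (Suc (Suc m)) = ereal \<sigma>"
  shows "(x \<sigma> - x \<tau>)\<^sup>2 = c\<^sup>2"
proof (rule time_Suc_Suc_cases[of m])
  assume "T (Suc (Suc m)) = \<infinity>"
  with assms show ?thesis by simp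
next
  fix \<tau>' \<sigma>'
  assume *: "T (Suc m) = ereal \<tau>'" "T (Suc (Suc m)) = ereal \<sigma>'" "0 \<le> \<tau>'" "\<tau>' \<le> \<sigma>'" "\<sigma>' \<le> 1"
      "x \<tau>' \<in> grid c r" "x \<sigma>' \<in> grid c r" "x \<sigma>' \<noteq> x \<tau>'"
      "\<And>t. t \<in> {\<tau>'..<\<sigma>'} \<Longrightarrow> x t \<in> grid c r \<Longrightarrow> x t = x \<tau>'"
  have [simp]: "\<tau>' = \<tau>" "\<sigma>' = \<sigma>" using *(1,2) assms by auto
  obtain q q' where q: "x \<tau> = c * of_int q + r" "x \<sigma> = c * of_int q' + r"
    using *(6,7) by (auto simp: grid_def)
  have cont': "continuous_on {\<tau>..\<sigma>} x"
    using *(3,5) by (auto intro: continuous_on_subset[OF cont])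
  have neq: "q \<noteq> q'" using *(8) q by auto
  have no_hit: "u = \<sigma> \<or> e = q" if "u \<in> {\<tau>..\<sigma>}" "x u = c * of_int e + r" for u e
  proof (cases "u = \<sigma>")
    case False
    then have "x u = x \<tau>" using *(9)[of u] that by (auto simp: grid_def)
    then show ?thesis using that q c_pos by simp
  qed simp
  have "q' = q + 1 \<or> q' = q - 1"
  proof (cases "q < q'")
    case True
    then have "x \<tau> \<le> c * of_int (q + 1) + r" "c * of_int (q + 1) + r \<le> x \<sigma>"
      using q c_pos by simp_all
    then obtain u where "u \<in> {\<tau>..\<sigma>}" "x u = c * of_int (q + 1) + r"
      using IVT'[of x \<tau> "c * of_int (q + 1) + r" \<sigma>] *(4) cont' by auto
    with no_hit[OF this] q have "c * real_of_int q' + r = c * real_of_int (q + 1) + r" by auto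
    then show ?thesis using c_pos by simp
  next
    case False
    then have "x \<sigma> \<le> c * of_int (q - 1) + r" "c * of_int (q - 1) + r \<le> x \<tau>"
      using q c_pos neq by simp_all
    then obtain u where "u \<in> {\<tau>..\<sigma>}" "x u = c * of_int (q - 1) + r"
      using IVT2'[of x \<sigma> "c * of_int (q - 1) + r" \<tau>] *(4) cont' by auto
    with no_hit[OF this] q have "c * real_of_int q' + r = c * real_of_int (q - 1) + r" by auto
    then show ?thesis using c_pos by simp
  qed
  then show ?thesis using q by (auto simp: algebra_simps power2_eq_square)
qed

section \<open>Evolution of the partition state\<close>

text \<open>Treats the first partition time and the later ones alike: \<open>set_option s\<close> is
  empty before the first hit and afterwards contains just the current grid point.\<close>

lemma state_next:
  assumes "state t l s" "0 \<le> t"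
  obtains a where "0 \<le> a" "a \<le> t"
    "T (Suc l) = Inf {ereal t |t. t \<in> {a..1} \<and> x t \<in> grid c r - set_option s}"
proof (cases l)
  case 0
  then show ?thesis using assms that[of 0] by (simp add: partition_state_def)
next
  case (Suc m)
  then have s: "T (Suc m) \<le> ereal t" "s = Some (x (real_of_ereal (T (Suc m))))"
    using assms by (auto simp: partition_state_def)
  show ?thesis
  proof (rule time_Suc_cases[of m])
    assume "T (Suc m) = \<infinity>"
    then show ?thesis using s by simp
  next
    fix \<tau> assume "T (Suc m) = ereal \<tau>" "\<tau> \<in> {0..1}"
    then show ?thesis using that[of \<tau>] s time_Suc_Suc[of m \<tau>] Suc by simp
  qed
qed

text \<open>A next partition time up to \<open>b\<close> would be a hit after \<open>a\<close> of a
  grid point other than the current one.\<close>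

lemma state_stay:
  assumes "state a l s" "0 \<le> a" "a \<le> b" "b \<le> 1"
    and "\<And>u. u \<in> {a..b} \<Longrightarrow> x u \<in> grid c r \<Longrightarrow> s = Some (x u)"
  shows "state b l s"
proof -
  have "ereal b < T (Suc l)"
  proof (rule ccontr)
    assume b: "\<not> ereal b < T (Suc l)"
    obtain a' where a': "0 \<le> a'"
      "T (Suc l) = Inf {ereal t |t. t \<in> {a'..1} \<and> x t \<in> grid c r - set_option s}"
      by (rule state_next[OF assms(1,2)])
    show False
      by (rule Inf_hitting_times[OF cont closed_grid_diff a'(1), of "set_option s"])
        (use a' b assms in \<open>force simp: partition_state_def\<close>)+
  qed
  moreover have "T l \<le> ereal b" if "l \<noteq> 0"
    using that assms(1,3) by (auto simp: partition_state_def intro: order_trans)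
  ultimately show ?thesis using assms(1) by (auto simp: partition_state_def)
qed

text \<open>The hit at \<open>u\<close> forces the next partition time into the interval, where its
  value can only be \<open>g\<close>. The one after it has a value other than \<open>g\<close>, so
  it comes after \<open>b\<close>.\<close>

lemma state_move:
  assumes "state a l s" "0 \<le> a" "a \<le> b" "b \<le> 1"
    and u: "u \<in> {a..b}" "x u = g" "g \<in> grid c r" "s \<noteq> Some g"
    and only: "\<And>u. u \<in> {a..b} \<Longrightarrow> x u \<in> grid c r \<Longrightarrow> x u = g"
  shows "state b (Suc l) (Some g)"
proof -
  obtain a' where a': "0 \<le> a'" "a' \<le> a"
    "T (Suc l) = Inf {ereal t |t. t \<in> {a'..1} \<and> x t \<in> grid c r - set_option s}"
    by (rule state_next[OF assms(1,2)])
  have gt: "ereal a < T (Suc l)" using assms(1) by (simp add: partition_state_def)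
  have "a' \<le> u" using a'(2) u by auto
  then have hit: "ereal u \<in> {ereal t |t. t \<in> {a'..1} \<and> x t \<in> grid c r - set_option s}"
    using u assms(4) by auto
  then have le: "T (Suc l) \<le> ereal u" unfolding a'(3) by (rule Inf_lower)
  obtain v where v: "T (Suc l) = ereal v" "v \<in> {a'..1}" "x v \<in> grid c r - set_option s"
    by (rule Inf_hitting_times[OF cont closed_grid_diff a'(1), of "set_option s"])
      (use le a' in auto)
  have v_in: "v \<in> {a..b}" using gt le v(1) u(1) by auto
  then have xv: "x v = g" using only v(3) by auto
  have "ereal b < T (Suc (Suc l))"
  proof (rule time_Suc_Suc_cases[of l])
    fix \<tau> \<sigma> assume *: "T (Suc l) = ereal \<tau>" "T (Suc (Suc l)) = ereal \<sigma>" "\<tau> \<le> \<sigma>"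
      "x \<sigma> \<in> grid c r" "x \<sigma> \<noteq> x \<tau>"
    then have "x \<sigma> \<noteq> g" using v(1) xv by simp
    then have "\<sigma> \<notin> {a..b}" using only *(4) by blast
    then show ?thesis using v_in v(1) * by auto
  qed auto
  then show ?thesis using v v_in xv by (auto simp: partition_state_def)
qed

lemma state_index_set:
  assumes "state t l s" shows "index_set_upto x c r t = {1..l}"
proof -
  have "T m \<le> ereal t \<longleftrightarrow> m \<le> l" if "1 \<le> m" for m
  proof
    assume "T m \<le> ereal t"
    moreover have "T (Suc l) \<le> T m" if "\<not> m \<le> l"
      using that time_mono[of l "m - 1"] by simp
    ultimately show "m \<le> l" using assms by (fastforce simp: partition_state_def)
  next
    assume "m \<le> l"
    with that have "T m \<le> T l" using time_mono[of "m - 1" "l - 1"] by simp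
    with that \<open>m \<le> l\<close> assms show "T m \<le> ereal t" by (auto simp: partition_state_def)
  qed
  then show ?thesis unfolding index_set_upto_def by auto
qed

text \<open>\<open>l\<close> partition times bound \<open>l - 1\<close> increments, each of square
  \<open>c\<^sup>2\<close>. Truncated subtraction also covers \<open>l = 0\<close>.\<close>

lemma quadratic_variation_eq:
  assumes "state t l s"
  shows "quadratic_variation x c r 0 t = c\<^sup>2 * real (l - 1)"
proof (cases "l = 0")
  case True
  then show ?thesis using state_index_set[OF assms] by (simp add: quadratic_variation_def)
next
  case False
  have first: "first_index x c r 0 = 1"
    unfolding first_index_def
    by (rule Least_equality) (use time_nonneg[of 0] in \<open>simp_all add: zero_ereal_def\<close>)
  have "last_index x c r t = l"
    unfolding last_index_def state_index_set[OF assms] using False by (intro Max_eqI) auto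
  moreover have "(x (real_of_ereal (T (m + 1))) - x (real_of_ereal (T m)))\<^sup>2 = c\<^sup>2"
    if m: "m \<in> {1..l - 1}" for m
  proof -
    obtain n where n: "m = Suc n" using m by (cases m) auto
    have "Suc m \<in> index_set_upto x c r t" "m \<in> index_set_upto x c r t"
      using m unfolding state_index_set[OF assms] by auto
    then have "T (Suc (Suc n)) \<noteq> \<infinity>" "T (Suc n) \<noteq> \<infinity>"
      by (auto simp: index_set_upto_def n)
    then obtain \<tau> \<sigma> where "T (Suc n) = ereal \<tau>" "T (Suc (Suc n)) = ereal \<sigma>"
      using time_Suc_cases[of n] time_Suc_cases[of "Suc n"] by metis
    then show ?thesis using partition_step n by simp
  qed
  ultimately show ?thesis
    unfolding quadratic_variation_def using False state_index_set[OF assms] first by simp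
qed

lemma state_mono:
  assumes "state t l s" "state t' l' s'" "t \<le> t'" shows "l \<le> l'"
proof -
  have "index_set_upto x c r t \<subseteq> index_set_upto x c r t'"
    using assms(3) by (auto simp: index_set_upto_def intro: order_trans)
  then have "{1..l} \<subseteq> {1..l'}" unfolding state_index_set[OF assms(1)] state_index_set[OF assms(2)] .
  then show ?thesis by (cases "l = 0") auto
qed

text \<open>The state at the later time supplies an index whose partition time exceeds
  \<open>t\<close>, so a least such index exists.\<close>

lemma state_exists:
  assumes "state t' l' s'" "t \<le> t'" shows "\<exists>l s. state t l s"
proof -
  define l where "l = (LEAST m. ereal t < T (Suc m))"
  have "ereal t < T (Suc l')" 
    using assms by (auto simp: partition_state_def intro: le_less_trans[of _ "ereal t'"])
  then have "ereal t < T (Suc l)" unfolding l_def by (rule LeastI)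
  moreover have "T l \<le> ereal t" if "l \<noteq> 0"
    using not_less_Least[of "l - 1" "\<lambda>m. ereal t < T (Suc m)"] that
    unfolding l_def[symmetric] by simp
  ultimately have "state t l (if l = 0 then None else Some (x (real_of_ereal (T l))))"
    by (simp add: partition_state_def)
  then show ?thesis by blast
qed

end

section \<open>Counting the changes of grid point\<close>

definition column_points :: "real \<Rightarrow> real \<Rightarrow> nat \<Rightarrow> nat \<Rightarrow> real set" where
  "column_points c r j i = grid c r \<inter> {real i / 3 ^ j<..<real (Suc i) / 3 ^ j}"

text \<open>The exit point is \<open>entry_point (\<not> up) P\<close>, the entry point of the
  reversed passage.\<close>

definition entry_point :: "bool \<Rightarrow> real set \<Rightarrow> real" where
  "entry_point up P = (if up then Min P else Max P)"

lemma entry_point_in: "finite P \<Longrightarrow> P \<noteq> {} \<Longrightarrow> entry_point up P \<in> P"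
  by (simp add: entry_point_def)

definition precedes :: "bool \<Rightarrow> real \<Rightarrow> real \<Rightarrow> bool" where
  "precedes up a b = (if up then a < b else b < a)"

lemma entry_point_Un:
  assumes "finite P" "finite Q" "P \<noteq> {}" "Q \<noteq> {}"
    and "\<And>a b. a \<in> P \<Longrightarrow> b \<in> Q \<Longrightarrow> precedes up a b"
  shows "entry_point up (P \<union> Q) = entry_point up P"
    and "entry_point (\<not> up) (P \<union> Q) = entry_point (\<not> up) Q"
proof -
  have *: "precedes up (Min P) (Min Q)" "precedes up (Max P) (Max Q)"
    using assms by auto
  have min_max: "(if up then min a b else max a' b') = (if up then a else a')"
    "(if \<not> up then min a b else max a' b') = (if \<not> up then b else b')"
    if "precedes up a b" "precedes up a' b'" for a b a' b' :: real
    using that by (auto simp: precedes_def)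
  show "entry_point up (P \<union> Q) = entry_point up P"
    and "entry_point (\<not> up) (P \<union> Q) = entry_point (\<not> up) Q"
    unfolding entry_point_def Min_Un[OF assms(1,3,2,4)] Max_Un[OF assms(1,3,2,4)]
    by (rule min_max[OF *])+
qed

text \<open>As \<open>b\<close> is off the grid, the integer indices run from
  \<open>\<lfloor>(a - r) / c\<rfloor> + 1\<close> to \<open>\<lfloor>(b - r) / c\<rfloor>\<close>.
  A difference of floors is within 1 of the difference itself.\<close>

lemma card_grid_interval:
  assumes "c > 0" "a \<le> b" "b \<notin> grid c r"
  shows "finite (grid c r \<inter> {a<..<b})"
    and "\<bar>real (card (grid c r \<inter> {a<..<b})) - (b - a) / c\<bar> < 1"
proof -
  define f where "f q = c * real_of_int q + r" for q
  have inj: "inj_on f A" for A using assms(1) by (auto simp: inj_on_def f_def)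
  have eq: "grid c r \<inter> {a<..<b} = f ` {\<lfloor>(a - r) / c\<rfloor> + 1..\<lfloor>(b - r) / c\<rfloor>}"
  proof (intro equalityI subsetI)
    fix y assume y: "y \<in> grid c r \<inter> {a<..<b}"
    then obtain q where q: "y = f q" by (auto simp: grid_def f_def)
    have "(a - r) / c < of_int q" "of_int q \<le> (b - r) / c"
      using y q assms(1) by (auto simp: f_def field_simps)
    then have "\<lfloor>(a - r) / c\<rfloor> + 1 \<le> q" "q \<le> \<lfloor>(b - r) / c\<rfloor>" by linarith+
    then show "y \<in> f ` {\<lfloor>(a - r) / c\<rfloor> + 1..\<lfloor>(b - r) / c\<rfloor>}" using q by auto
  next
    fix y assume "y \<in> f ` {\<lfloor>(a - r) / c\<rfloor> + 1..\<lfloor>(b - r) / c\<rfloor>}"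
    then obtain q where q: "y = f q" "\<lfloor>(a - r) / c\<rfloor> + 1 \<le> q" "q \<le> \<lfloor>(b - r) / c\<rfloor>" by auto
    then have "(a - r) / c < of_int q" "of_int q \<le> (b - r) / c" by linarith+
    then have "a < y" "y \<le> b" using q(1) assms(1) by (auto simp: f_def field_simps)
    moreover have "y \<in> grid c r" using q(1) by (auto simp: grid_def f_def)
    moreover from this have "y \<noteq> b" using assms(3) by blast
    ultimately show "y \<in> grid c r \<inter> {a<..<b}" by auto
  qed
  show "finite (grid c r \<inter> {a<..<b})" unfolding eq by simp
  have "\<lfloor>(a - r) / c\<rfloor> \<le> \<lfloor>(b - r) / c\<rfloor>"
    using assms(1,2) by (intro floor_mono divide_right_mono) auto
  then have "real (card (grid c r \<inter> {a<..<b}))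
      = of_int \<lfloor>(b - r) / c\<rfloor> - of_int \<lfloor>(a - r) / c\<rfloor>"
    unfolding eq card_image[OF inj] by simp
  moreover have "(b - a) / c = (b - r) / c - (a - r) / c" by (simp flip: diff_divide_distrib)
  ultimately show "\<bar>real (card (grid c r \<inter> {a<..<b})) - (b - a) / c\<bar> < 1"
    by linarith
qed

text \<open>\<open>crossing_changes c r m j i\<close> is the number of changes of the last visited grid point while
  the curve crosses column \<open>i\<close> of width \<open>3\<^sup>-\<^sup>j\<close>, where \<open>j + m\<close> is the depth at which the
  crossings become monotone as far as the grid can see. Each column is subdivided into three, each
  crossed three times in alternating directions; only the two passages to the next
  subcolumn contribute an additional change.\<close>

fun crossing_changes :: "real \<Rightarrow> real \<Rightarrow> nat \<Rightarrow> nat \<Rightarrow> nat \<Rightarrow> nat" where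
  "crossing_changes c r 0 j i = card (column_points c r j i) - 1"
| "crossing_changes c r (Suc m) j i = 3 * crossing_changes c r m (Suc j) (3 * i)
     + 3 * crossing_changes c r m (Suc j) (3 * i + 1)
     + 3 * crossing_changes c r m (Suc j) (3 * i + 2) + 2"

text \<open>The bounds place \<open>3 ^ N * c\<close> above 1/3 and at most at 1. This makes
  \<open>N\<close> the critical depth: columns of depth \<open>N\<close> contain a grid point, those
  of depth \<open>Suc N\<close> at most one.\<close>

locale peano_partition = lebesgue_partition peano_x c r for c r +
  fixes N :: nat
  assumes no_triadic: "real i / 3 ^ j \<notin> grid c r"
    and c_le: "c \<le> 1 / 3 ^ N" and c_gt: "c > 1 / 3 ^ Suc N"
begin

abbreviation "points \<equiv> column_points c r"

lemma finite_points: "finite (points j i)"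
  and card_points: "\<bar>real (card (points j i)) - 1 / (3 ^ j * c)\<bar> < 1"
proof -
  have "real i / 3 ^ j \<le> real (Suc i) / 3 ^ j" by (simp add: divide_right_mono)
  note * = card_grid_interval[OF c_pos this no_triadic[of "Suc i" j]]
  from *(1) show "finite (points j i)" by (simp add: column_points_def)
  have "(real (Suc i) / 3 ^ j - real i / 3 ^ j) / c = 1 / (3 ^ j * c)"
    using c_pos by (simp add: field_simps)
  with *(2) show "\<bar>real (card (points j i)) - 1 / (3 ^ j * c)\<bar> < 1"
    by (simp add: column_points_def)
qed

lemma points_nonempty:
  assumes "j \<le> N" shows "points j i \<noteq> {}"
proof -
  have "c \<le> 1 / 3 ^ j"
    using c_le power_increasing[OF assms, of "3::real"]
    by (smt (verit) frac_le zero_less_power)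
  then have "1 / (3 ^ j * c) \<ge> 1" using c_pos by (simp add: field_simps)
  then have "card (points j i) \<noteq> 0" using card_points[of j i] by auto
  then show ?thesis by auto
qed

lemma card_points_finest: "card (points (Suc N) i) \<le> 1"
proof -
  have "1 / (3 ^ Suc N * c) < 1" using c_gt c_pos by (simp add: field_simps)
  then show ?thesis using card_points[of "Suc N" i] by linarith
qed

text \<open>The two inner boundaries are triadic, hence off the grid, so the open subcolumns miss no
  grid point.\<close>

lemma points_split:
  "points j i = points (Suc j) (3 * i) \<union> points (Suc j) (3 * i + 1) \<union> points (Suc j) (3 * i + 2)"
proof -
  have e: "real i / 3 ^ j = real (3 * i) / 3 ^ Suc j"
     "real (Suc i) / 3 ^ j = real (Suc (3 * i + 2)) / 3 ^ Suc j"
    by (simp_all add: field_simps)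
  have three: "{a<..<d} = {a<..<b} \<union> {b<..<c} \<union> {c<..<d} \<union> {b, c}"
    if "a < b" "b < c" "c < d" for a b c d :: real
    using that by auto
  have "real (3 * i) / 3 ^ Suc j < real (Suc (3 * i)) / 3 ^ Suc j"
    "real (Suc (3 * i)) / 3 ^ Suc j < real (Suc (3 * i + 1)) / 3 ^ Suc j"
    "real (Suc (3 * i + 1)) / 3 ^ Suc j < real (Suc (3 * i + 2)) / 3 ^ Suc j"
    by (intro divide_strict_right_mono; simp)+
  then have "{real (3 * i) / 3 ^ Suc j<..<real (Suc (3 * i + 2)) / 3 ^ Suc j}
      = {real (3 * i) / 3 ^ Suc j<..<real (Suc (3 * i)) / 3 ^ Suc j}
      \<union> {real (Suc (3 * i)) / 3 ^ Suc j<..<real (Suc (3 * i + 1)) / 3 ^ Suc j}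
      \<union> {real (Suc (3 * i + 1)) / 3 ^ Suc j<..<real (Suc (3 * i + 2)) / 3 ^ Suc j}
      \<union> {real (Suc (3 * i)) / 3 ^ Suc j, real (Suc (3 * i + 1)) / 3 ^ Suc j}" 
    by (rule three)
  then show ?thesis
    unfolding column_points_def e
    using no_triadic[of "Suc (3 * i)" "Suc j"] no_triadic[of "Suc (3 * i + 1)" "Suc j"]
    by auto
qed

lemma points_less:
  assumes "a \<in> points j i" "b \<in> points j i'" "i < i'"
  shows "a < b"
proof -
  have "a < real (Suc i) / 3 ^ j" "real i' / 3 ^ j < b"
    using assms by (auto simp: column_points_def)
  moreover have "real (Suc i) / 3 ^ j \<le> real i' / 3 ^ j"
    using assms(3) by (intro divide_right_mono) auto
  ultimately show ?thesis by linarith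
qed

lemma points_disjoint: "i \<noteq> i' \<Longrightarrow> points j i \<inter> points j i' = {}"
  using points_less by (metis disjoint_iff less_irrefl linorder_neqE_nat)

lemma card_points_split:
  "card (points j i) = card (points (Suc j) (3 * i)) + card (points (Suc j) (3 * i + 1))
     + card (points (Suc j) (3 * i + 2))"
proof -
  have "points (Suc j) (3 * i) \<inter> points (Suc j) (3 * i + 1) = {}"
    "(points (Suc j) (3 * i) \<union> points (Suc j) (3 * i + 1)) \<inter> points (Suc j) (3 * i + 2) = {}"
    using points_disjoint[of "3 * i" "3 * i + 1" "Suc j"] points_disjoint[of "3 * i" "3 * i + 2" "Suc j"]
      points_disjoint[of "3 * i + 1" "3 * i + 2" "Suc j"]
    by auto
  then show ?thesis
    unfolding points_split[of j i] by (simp add: card_Un_disjoint finite_points)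
qed

text \<open>Cardinalities add up over subcolumns, and the constant satisfies
  \<open>9 * (3 * 9 ^ m + 1) / 4 - 2 = (3 * 9 ^ Suc m + 1) / 4\<close>. At depth \<open>N\<close>
  the column is nonempty, so \<open>card - 1\<close> is a true subtraction.\<close>

lemma crossing_changes_eq:
  "j + m = N \<Longrightarrow>
   real (crossing_changes c r m j i) = 3 ^ m * real (card (points j i)) - (3 * 9 ^ m + 1) / 4"
proof (induction m arbitrary: j i)
  case 0
  then have "card (points j i) \<noteq> 0" using points_nonempty[of j i] finite_points by simp
  then show ?case by (simp add: of_nat_diff)
next
  case (Suc m)
  then have IH: "real (crossing_changes c r m (Suc j) k)
      = 3 ^ m * real (card (points (Suc j) k)) - (3 * 9 ^ m + 1) / 4" for k
    by simp
  have "real (crossing_changes c r (Suc m) j i) = 3 * real (crossing_changes c r m (Suc j) (3 * i))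
     + 3 * real (crossing_changes c r m (Suc j) (3 * i + 1))
     + 3 * real (crossing_changes c r m (Suc j) (3 * i + 2)) + 2"
    by simp
  then show ?case unfolding IH card_points_split[of j i] by (simp add: field_simps)
qed

text \<open>Between \<open>t\<close> and \<open>t'\<close> the curve runs through the grid points \<open>P\<close> in the direction given by
  \<open>up\<close>. The last visited grid point then changes \<open>k\<close> times, and once more on entry unless the
  entry point was also the last one visited before.\<close>

definition traversal :: "real \<Rightarrow> real \<Rightarrow> bool \<Rightarrow> real set \<Rightarrow> nat \<Rightarrow> bool" where
  "traversal t t' up P k \<longleftrightarrow> (\<forall>l s. state t l s \<longrightarrow>
     (if P = {} then state t' l s
      else state t' (l + k + (if s = Some (entry_point up P) then 0 else 1))
             (Some (entry_point (\<not> up) P))))"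

lemma traversalD:
  assumes "traversal t t' up P k" "P \<noteq> {}" "state t l s"
  shows "state t' (l + k + (if s = Some (entry_point up P) then 0 else 1))
    (Some (entry_point (\<not> up) P))"
  using assms by (simp add: traversal_def)

section \<open>Composition of traversals\<close>

lemma traversal_empty_left:
  "traversal t1 t2 up {} k \<Longrightarrow> traversal t2 t3 up Q m \<Longrightarrow> traversal t1 t3 up Q m"
  by (simp add: traversal_def)

lemma traversal_empty_right:
  "traversal t1 t2 up P k \<Longrightarrow> traversal t2 t3 up {} m \<Longrightarrow> traversal t1 t3 up P k"
  by (auto simp: traversal_def)

text \<open>The extra change is the step from the exit point of \<open>P\<close> to the entry point
  of \<open>Q\<close>, which differ because \<open>P\<close> precedes \<open>Q\<close>.\<close>

lemma traversal_Un:
  assumes "traversal t1 t2 up P k" "traversal t2 t3 up Q m"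
    and "finite P" "finite Q" "P \<noteq> {}" "Q \<noteq> {}"
    and prec: "\<And>a b. a \<in> P \<Longrightarrow> b \<in> Q \<Longrightarrow> precedes up a b"
  shows "traversal t1 t3 up (P \<union> Q) (k + m + 1)"
proof -
  have "precedes up (entry_point (\<not> up) P) (entry_point up Q)"
    using assms(3-6) by (intro prec entry_point_in)
  then have neq: "entry_point (\<not> up) P \<noteq> entry_point up Q"
    by (auto simp: precedes_def split: if_splits)
  have ep: "entry_point up (P \<union> Q) = entry_point up P"
    "entry_point (\<not> up) (P \<union> Q) = entry_point (\<not> up) Q"
    by (rule entry_point_Un; use assms in auto)+
  show ?thesis
    unfolding traversal_def
  proof (intro allI impI)
    fix l s assume "state t1 l s"
    define \<delta> :: nat where "\<delta> = (if s = Some (entry_point up P) then 0 else 1)"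
    have "state t2 (l + k + \<delta>) (Some (entry_point (\<not> up) P))"
      unfolding \<delta>_def by (rule traversalD) fact+
    from traversalD[OF assms(2,6) this]
    have "state t3 (l + k + \<delta> + m + 1) (Some (entry_point (\<not> up) Q))"
      using neq by simp
    moreover have "l + k + \<delta> + m + 1 = l + (k + m + 1) + \<delta>" by simp
    ultimately have "state t3 (l + (k + m + 1) + \<delta>) (Some (entry_point (\<not> up) Q))"
      by (simp only:)
    then show "if P \<union> Q = {} then state t3 l s
        else state t3 (l + (k + m + 1) + (if s = Some (entry_point up (P \<union> Q)) then 0 else 1))
             (Some (entry_point (\<not> up) (P \<union> Q)))"
      using assms(5) unfolding ep \<delta>_def by (auto split: if_splits)
  qed
qed

text \<open>Admits empty sets, which can occur at depth \<open>Suc N\<close>. For nonempty sets the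
  passage supplies the one change missing from the sum of the two counts.\<close>

lemma traversal_Un_card:
  assumes "traversal t1 t2 up P (card P - 1)" "traversal t2 t3 up Q (card Q - 1)"
    and "finite P" "finite Q"
    and prec: "\<And>a b. a \<in> P \<Longrightarrow> b \<in> Q \<Longrightarrow> precedes up a b"
  shows "traversal t1 t3 up (P \<union> Q) (card (P \<union> Q) - 1)"
proof -
  consider "P = {}" | "Q = {}" | "P \<noteq> {}" "Q \<noteq> {}" by blast
  then show ?thesis
  proof cases
    case 1
    then show ?thesis using traversal_empty_left[OF assms(1)[unfolded 1] assms(2)] by simp
  next
    case 2
    then show ?thesis using traversal_empty_right[OF assms(1) assms(2)[unfolded 2]] by simp
  next
    case 3
    have "P \<inter> Q = {}" using prec by (fastforce simp: precedes_def split: if_splits)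
    then have "card (P \<union> Q) = card P + card Q" by (simp add: card_Un_disjoint assms(3,4))
    moreover have "card P \<noteq> 0" "card Q \<noteq> 0" using 3 assms(3,4) by auto
    ultimately have "card (P \<union> Q) - 1 = (card P - 1) + (card Q - 1) + 1" by linarith
    then show ?thesis using traversal_Un[OF assms(1-4) 3 prec] by simp
  qed
qed

text \<open>After a reversal the entry point is the point last visited, so only the first of the
  three crossings can cost an entry change.\<close>

lemma traversal_zigzag:
  assumes "traversal t1 t2 up P k" "traversal t2 t3 (\<not> up) P k" "traversal t3 t4 up P k"
  shows "traversal t1 t4 up P (3 * k)"
proof (cases "P = {}")
  case True
  then show ?thesis using assms by (simp add: traversal_def)
next
  case False
  show ?thesis
    unfolding traversal_def
  proof (intro allI impI)
    fix l s assume "state t1 l s"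
    define \<delta> :: nat where "\<delta> = (if s = Some (entry_point up P) then 0 else 1)"
    have "state t2 (l + k + \<delta>) (Some (entry_point (\<not> up) P))"
      unfolding \<delta>_def by (rule traversalD) fact+
    from traversalD[OF assms(2) False this]
    have "state t3 (l + k + \<delta> + k) (Some (entry_point up P))" by simp
    from traversalD[OF assms(3) False this]
    have "state t4 (l + k + \<delta> + k + k) (Some (entry_point (\<not> up) P))" by simp
    moreover have "l + k + \<delta> + k + k = l + 3 * k + \<delta>" by simp
    ultimately show "if P = {} then state t4 l s
      else state t4 (l + 3 * k + (if s = Some (entry_point up P) then 0 else 1))
               (Some (entry_point (\<not> up) P))"
      using False unfolding \<delta>_def by simp
  qed
qed

text \<open>The only grid point that can be hit is the single point \<open>g\<close> of the column,
  and if it exists it is hit. So the state stays, or moves once, to \<open>g\<close>.\<close>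

lemma traversal_finest:
  assumes "peano_block (Suc N) a i up"
  shows "traversal a (a + 1 / 9 ^ Suc N) up (points (Suc N) i) 0"
  unfolding traversal_def
proof (intro allI impI)
  let ?b = "a + 1 / 9 ^ Suc N"
  have ab: "0 \<le> a" "a \<le> ?b" "?b \<le> 1" using assms by (auto simp: peano_block_def)
  fix l s assume st: "state a l s"
  have hit: "peano_x u \<in> points (Suc N) i" if "u \<in> {a..?b}" "peano_x u \<in> grid c r" for u
  proof -
    have "peano_x u \<in> {real i / 3 ^ Suc N..real (Suc i) / 3 ^ Suc N}"
      by (rule peano_block_bounds[OF assms that(1)])
    moreover have "peano_x u \<noteq> real i / 3 ^ Suc N" "peano_x u \<noteq> real (Suc i) / 3 ^ Suc N"
      using that(2) no_triadic by metis+
    ultimately show ?thesis using that(2) by (simp add: column_points_def)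
  qed
  show "if points (Suc N) i = {} then state ?b l s
    else state ?b (l + 0 + (if s = Some (entry_point up (points (Suc N) i)) then 0 else 1))
             (Some (entry_point (\<not> up) (points (Suc N) i)))"
  proof (cases "points (Suc N) i = {}")
    case True
    then have "state ?b l s" using hit by (intro state_stay[OF st ab]) auto
    with True show ?thesis by simp
  next
    case False
    then obtain g where g: "points (Suc N) i = {g}"
      using card_points_finest[of i] finite_points[of "Suc N" i]
      by (metis One_nat_def card_0_eq card_1_singletonE le_Suc_eq le_zero_eq)
    have e: "entry_point d {g} = g" for d by (simp add: entry_point_def)
    have g_in: "g \<in> grid c r" "g \<in> {real i / 3 ^ Suc N..real (Suc i) / 3 ^ Suc N}"
    proof -
      have "g \<in> points (Suc N) i" using g by simp
      then show "g \<in> grid c r" "g \<in> {real i / 3 ^ Suc N..real (Suc i) / 3 ^ Suc N}"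
        by (auto simp: column_points_def simp del: power_Suc of_nat_Suc)
    qed
    have only: "\<And>u. u \<in> {a..?b} \<Longrightarrow> peano_x u \<in> grid c r \<Longrightarrow> peano_x u = g" using hit g by blast
    show ?thesis
    proof (cases "s = Some g")
      case True
      then have "state ?b l s" using only by (intro state_stay[OF st ab]) auto
      with True g e show ?thesis by simp
    next
      case s: False
      obtain u where "u \<in> {a..?b}" "peano_x u = g"
        using peano_block_surj[OF assms g_in(2)] by blast
      then have "state ?b (Suc l) (Some g)" by (rule state_move[OF st ab _ _ g_in(1) s only])
      with s g e show ?thesis by simp
    qed
  qed
qed

text \<open>The three consecutive time blocks \<open>v = 0, 1, 2\<close> all cross the subcolumn
  \<open>i'\<close>, in alternating directions, so the zigzag rule applies.\<close>

lemma traversal_third: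
  assumes b: "peano_block j a i up" and u: "u \<le> 2"
    and sub: "\<And>a i up. peano_block (Suc j) a i up \<Longrightarrow>
      traversal a (a + 1 / 9 ^ Suc j) up (points (Suc j) i) (k i)"
  defines "i' \<equiv> 3 * i + (if up then u else 2 - u)"
  shows "traversal (a + real (3 * u) / 9 ^ Suc j) (a + real (3 * Suc u) / 9 ^ Suc j) up
    (points (Suc j) i') (3 * k i')"
proof -
  have *: "traversal (a + real (3 * u + v) / 9 ^ Suc j) (a + real (3 * u + Suc v) / 9 ^ Suc j)
      (up = even v) (points (Suc j) i') (k i')" if "v \<le> 2" for v
  proof -
    have "a + real (3 * u + v) / 9 ^ Suc j + 1 / 9 ^ Suc j = a + real (3 * u + Suc v) / 9 ^ Suc j"
      by (simp add: add_divide_distrib)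
    with sub[OF peano_block_sub[OF b u that]] show ?thesis unfolding i'_def by (simp only:)
  qed
  have "traversal (a + real (3 * u + 0) / 9 ^ Suc j) (a + real (3 * u + Suc 2) / 9 ^ Suc j) up
      (points (Suc j) i') (3 * k i')"
  proof (rule traversal_zigzag)
    show "traversal (a + real (3 * u + 0) / 9 ^ Suc j) (a + real (3 * u + 1) / 9 ^ Suc j) up
        (points (Suc j) i') (k i')"
      using *[of 0] by simp
    show "traversal (a + real (3 * u + 1) / 9 ^ Suc j) (a + real (3 * u + 2) / 9 ^ Suc j) (\<not> up)
        (points (Suc j) i') (k i')"
      using *[of 1] by (simp add: numeral_2_eq_2)
    show "traversal (a + real (3 * u + 2) / 9 ^ Suc j) (a + real (3 * u + Suc 2) / 9 ^ Suc j) up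
        (points (Suc j) i') (k i')"
      using *[of 2] by simp
  qed
  moreover have "3 * u + Suc 2 = 3 * Suc u" by simp
  ultimately show ?thesis by (simp only: add_0_right)
qed

lemma traversal_block:
  assumes "j + m = N" "peano_block j a i up"
  shows "traversal a (a + 1 / 9 ^ j) up (points j i) (crossing_changes c r m j i)"
  using assms
proof (induction m arbitrary: j a i up)
  case 0
  then have j: "j = N" by simp
  note b = 0(2)
  define p where "p u = a + real (3 * u) / 9 ^ Suc j" for u
  define P where "P u = points (Suc j) (3 * i + (if up then u else 2 - u))" for u
  \<comment> \<open>With at most one point per subcolumn, \<open>3 * 0\<close> and
    \<open>card (P u) - 1\<close> are both 0. The sets \<open>P 0\<close>, \<open>P 1\<close>,
    \<open>P 2\<close> come in the order of passage, whichever the direction.\<close>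
  have third: "traversal (p u) (p (Suc u)) up
      (P u) (card (P u) - 1)" if "u \<le> 2" for u
    using traversal_third[OF b that, of "\<lambda>_. 0"] traversal_finest card_points_finest
    unfolding j P_def p_def by simp
  have third01: "traversal (p 0) (p 1) up (P 0) (card (P 0) - 1)"
    and third12: "traversal (p 1) (p 2) up (P 1) (card (P 1) - 1)"
    and third23: "traversal (p 2) (p 3) up (P 2) (card (P 2) - 1)"
    using third[of 0] third[of 1] third[of 2] by (simp_all add: numeral_2_eq_2 numeral_3_eq_3)
  have fin: "finite (P u)" for u by (simp add: P_def finite_points)
  have prec: "precedes up x y" if "x \<in> P u" "y \<in> P v" "u < v" "v \<le> 2" for x y u v
    using that points_less unfolding P_def precedes_def by (cases up) (auto elim!: points_less)
  have un: "points j i = P 0 \<union> P 1 \<union> P 2"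
    unfolding points_split[of j i] P_def by (cases up) auto
  have "traversal (p 0) (p 2) up
      (P 0 \<union> P 1) (card (P 0 \<union> P 1) - 1)"
    by (rule traversal_Un_card[OF third01 third12]) (auto simp: fin prec)
  then have "traversal (p 0) (p 3) up
      (P 0 \<union> P 1 \<union> P 2) (card (P 0 \<union> P 1 \<union> P 2) - 1)"
    by (rule traversal_Un_card[OF _ third23]) (auto simp: fin prec)
  then show ?case unfolding un[symmetric] p_def by simp
next
  case (Suc m)
  note b = Suc.prems(2)
  define p where "p u = a + real (3 * u) / 9 ^ Suc j" for u
  define P where "P u = points (Suc j) (3 * i + (if up then u else 2 - u))" for u
  define k where "k u = 3 * crossing_changes c r m (Suc j) (3 * i + (if up then u else 2 - u))" for u
  have third: "traversal (p u) (p (Suc u)) up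
      (P u) (k u)" if "u \<le> 2" for u
    using traversal_third[OF b that Suc.IH] Suc.prems(1)
    unfolding P_def k_def p_def by simp
  have third01: "traversal (p 0) (p 1) up (P 0) (k 0)"
    and third12: "traversal (p 1) (p 2) up (P 1) (k 1)"
    and third23: "traversal (p 2) (p 3) up (P 2) (k 2)"
    using third[of 0] third[of 1] third[of 2] by (simp_all add: numeral_2_eq_2 numeral_3_eq_3)
  \<comment> \<open>Here \<open>Suc j \<le> N\<close>, so every subcolumn has a grid point and each
    of the two passages costs exactly one change.\<close>
  have fin: "finite (P u)" and ne: "P u \<noteq> {}" for u
    using Suc.prems(1) by (simp_all add: P_def finite_points points_nonempty)
  have prec: "precedes up x y" if "x \<in> P u" "y \<in> P v" "u < v" "v \<le> 2" for x y u v
    using that points_less unfolding P_def precedes_def by (cases up) (auto elim!: points_less)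
  have un: "points j i = P 0 \<union> P 1 \<union> P 2"
    unfolding points_split[of j i] P_def by (cases up) auto
  have "traversal (p 0) (p 2) up
      (P 0 \<union> P 1) (k 0 + k 1 + 1)"
    by (rule traversal_Un[OF third01 third12]) (auto simp: fin ne prec)
  then have "traversal (p 0) (p 3) up
      (P 0 \<union> P 1 \<union> P 2) (k 0 + k 1 + 1 + k 2 + 1)"
    by (rule traversal_Un[OF _ third23]) (auto simp: fin ne prec)
  moreover have "k 0 + k 1 + 1 + k 2 + 1 = crossing_changes c r (Suc m) j i"
    unfolding k_def by (cases up) simp_all
  ultimately show ?case unfolding un[symmetric] p_def by simp
qed

end

section \<open>The limit\<close>

context peano_partition
begin

text \<open>The curve starts at 0, which is triadic and hence off the grid.\<close>

lemma initial_state: "state 0 0 None"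
proof -
  have "peano_x 0 \<notin> grid c r" using no_triadic[of 0 0] by (simp add: peano_x_0)
  then have "T (Suc 0) \<noteq> 0"
    by (metis PInfty_neq_ereal(1) ereal_eq_0(1) infinity_ereal_def time_Suc_cases)
  then have "0 < T (Suc 0)" using time_nonneg[of 0] by (simp add: order.strict_iff_order)
  then show ?thesis by (simp add: partition_state_def zero_ereal_def)
qed

text \<open>Inserting \<open>G = 1 / (3 ^ M * c) + \<epsilon>\<close> into the closed form cancels
  the main terms exactly. What remains is
  \<open>c\<^sup>2 * 3 ^ m * \<epsilon> - c\<^sup>2 / 4\<close>, which is of order \<open>c\<close>
  because \<open>c * 3 ^ m \<le> 1\<close>.\<close>

lemma column_variation:
  assumes "M \<le> N"
  shows "\<bar>c\<^sup>2 * real (crossing_changes c r (N - M) M i)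
      - (3 ^ N * c - 3 / 4 * (3 ^ N * c)\<^sup>2) / 9 ^ M\<bar> \<le> 2 * c"
proof -
  define m where "m = N - M"
  define G where "G = real (card (points M i))"
  define \<epsilon> where "\<epsilon> = G - 1 / (3 ^ M * c)"
  have N: "N = M + m" using assms by (simp add: m_def)
  have eq: "real (crossing_changes c r m M i) = 3 ^ m * G - (3 * 9 ^ m + 1) / 4"
    unfolding G_def by (rule crossing_changes_eq) (simp add: N)
  have pow: "(9::real) ^ k = (3 ^ k)\<^sup>2" for k by (simp add: power2_eq_square flip: power_mult_distrib)
  have "c\<^sup>2 * real (crossing_changes c r m M i)
      - (3 ^ N * c - 3 / 4 * (3 ^ N * c)\<^sup>2) / 9 ^ M = c\<^sup>2 * 3 ^ m * \<epsilon> - c\<^sup>2 / 4"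
    using c_pos unfolding eq \<epsilon>_def N pow by (simp add: field_simps power_add power2_eq_square)
  moreover have "\<bar>\<epsilon>\<bar> < 1" using card_points[of M i] by (simp add: \<epsilon>_def G_def)
  moreover have cm: "c * 3 ^ m \<le> 1"
  proof -
    have "(3::real) ^ m \<le> 3 ^ N" by (rule power_increasing) (simp_all add: N)
    then have "c * 3 ^ m \<le> c * 3 ^ N" using c_pos by simp
    also have "\<dots> \<le> 1" using c_le by (simp add: field_simps)
    finally show ?thesis .
  qed
  moreover have "c\<^sup>2 * 3 ^ m \<le> c" using mult_left_mono[OF cm, of c] c_pos by (simp add: power2_eq_square mult_ac)
  moreover have "\<bar>c\<^sup>2 * 3 ^ m * \<epsilon>\<bar> \<le> c\<^sup>2 * 3 ^ m"
    using \<open>\<bar>\<epsilon>\<bar> < 1\<close> by (simp add: abs_mult mult_left_le)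
  moreover have "c\<^sup>2 \<le> c\<^sup>2 * 3 ^ m" using mult_left_mono[of 1 "3 ^ m" "c\<^sup>2"] by simp
  moreover have "0 \<le> c\<^sup>2" by simp
  ultimately show ?thesis unfolding m_def[symmetric] abs_le_iff by linarith
qed

text \<open>Each block adds an error of at most \<open>2 * c\<close> from its column and at most
  \<open>c\<^sup>2 \<le> c\<close> from a possible entry change \<open>\<delta>\<close>.\<close>

lemma quadratic_variation_triadic:
  assumes "M \<le> N" "k \<le> 9 ^ M"
  defines "V \<equiv> 3 ^ N * c - 3 / 4 * (3 ^ N * c)\<^sup>2"
  shows "\<exists>l s. state (real k / 9 ^ M) l s \<and>
    \<bar>c\<^sup>2 * real l - real k * V / 9 ^ M\<bar> \<le> 3 * real k * c"
  using assms(2)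
proof (induction k)
  case 0
  then show ?case using initial_state by auto
next
  case (Suc k)
  then obtain l s where l: "state (real k / 9 ^ M) l s"
      "\<bar>c\<^sup>2 * real l - real k * V / 9 ^ M\<bar> \<le> 3 * real k * c"
    by auto
  obtain i up where b: "peano_block M (real k / 9 ^ M) i up"
    using peano_block_exists[of k M] Suc.prems by auto
  define C where "C = crossing_changes c r (N - M) M i"
  have "traversal (real k / 9 ^ M) (real k / 9 ^ M + 1 / 9 ^ M) up (points M i) C"
    unfolding C_def by (rule traversal_block[OF _ b]) (use assms(1) in simp)
  from traversalD[OF this points_nonempty[OF assms(1)] l(1)]
  obtain \<delta> :: nat and s' where st: "state (real k / 9 ^ M + 1 / 9 ^ M) (l + C + \<delta>) s'" and \<delta>: "\<delta> \<le> 1"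
    by (auto split: if_splits)
  have "c \<le> 1" using c_le by (rule order_trans) simp
  then have "c\<^sup>2 \<le> c" using c_pos by (simp add: power2_eq_square)
  moreover have "c\<^sup>2 * real \<delta> \<le> c\<^sup>2" using mult_left_mono[of "real \<delta>" 1 "c\<^sup>2"] \<delta> by simp
  moreover have "\<bar>c\<^sup>2 * real C - V / 9 ^ M\<bar> \<le> 2 * c"
    using column_variation[OF assms(1), of i] by (simp add: C_def V_def)
  moreover have "c\<^sup>2 * real (l + C + \<delta>) = c\<^sup>2 * real l + c\<^sup>2 * real C + c\<^sup>2 * real \<delta>"
    by (simp add: algebra_simps)
  moreover have "real (Suc k) * V / 9 ^ M = real k * V / 9 ^ M + V / 9 ^ M"
    by (simp add: field_simps)
  moreover have "3 * real (Suc k) * c = 3 * real k * c + 3 * c" by (simp add: algebra_simps)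
  moreover have "0 \<le> c\<^sup>2 * real \<delta>" by simp
  ultimately have "\<bar>c\<^sup>2 * real (l + C + \<delta>) - real (Suc k) * V / 9 ^ M\<bar> \<le> 3 * real (Suc k) * c"
    using l(2) unfolding abs_le_iff by linarith
  moreover have "real k / 9 ^ M + 1 / 9 ^ M = real (Suc k) / 9 ^ M" by (simp add: field_simps)
  ultimately show ?case using st by metis
qed

lemma state_exists_unit:
  assumes "t \<le> 1" obtains l s where "state t l s"
proof -
  \<comment> \<open>\<open>M = 0\<close> and \<open>k = 1\<close>: the whole unit interval is one
    block.\<close>
  obtain l s where "state 1 l s" using quadratic_variation_triadic[of 0 1] by auto
  then show ?thesis using state_exists[OF _ assms] that by blast
qed

lemma quadratic_variation_mono:
  assumes "t \<le> t'" "t' \<le> 1"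
  shows "quadratic_variation peano_x c r 0 t \<le> quadratic_variation peano_x c r 0 t'"
proof -
  obtain l s where l: "state t l s" using state_exists_unit assms by (metis order_trans)
  obtain l' s' where l': "state t' l' s'" using state_exists_unit assms by metis
  have "l \<le> l'" by (rule state_mono[OF l l' assms(1)])
  then show ?thesis
    unfolding quadratic_variation_eq[OF l] quadratic_variation_eq[OF l']
    by (intro mult_left_mono) auto
qed

text \<open>Passing from \<open>l\<close> times to \<open>l - 1\<close> increments costs at most
  another \<open>c\<close>; the rest is \<open>k \<le> 9 ^ M\<close>.\<close>

lemma quadratic_variation_triadic_bound:
  assumes "M \<le> N" "k \<le> 9 ^ M"
  defines "V \<equiv> 3 ^ N * c - 3 / 4 * (3 ^ N * c)\<^sup>2"
  shows "\<bar>quadratic_variation peano_x c r 0 (real k / 9 ^ M) - real k / 9 ^ M * V\<bar>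
    \<le> 4 * 9 ^ M * c"
proof -
  obtain l s where l: "state (real k / 9 ^ M) l s"
    "\<bar>c\<^sup>2 * real l - real k * V / 9 ^ M\<bar> \<le> 3 * real k * c"
    using quadratic_variation_triadic[OF assms(1,2)] unfolding V_def by blast
  have "c \<le> 1" using c_le by (rule order_trans) simp
  then have "c\<^sup>2 \<le> c" using c_pos by (simp add: power2_eq_square)
  moreover have "c\<^sup>2 * real (l - 1) \<le> c\<^sup>2 * real l" by (intro mult_left_mono) auto
  moreover have "c\<^sup>2 * real l \<le> c\<^sup>2 * (real (l - 1) + 1)" by (intro mult_left_mono) auto
  then have "c\<^sup>2 * real l \<le> c\<^sup>2 * real (l - 1) + c\<^sup>2" by (simp add: algebra_simps)
  moreover have "c * real k \<le> c * 9 ^ M" 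
  proof -
    have "real k \<le> 9 ^ M" using assms(2) by (metis of_nat_le_iff of_nat_numeral of_nat_power)
    then show ?thesis using c_pos by simp
  qed
  moreover have "c \<le> c * 9 ^ M" using mult_left_mono[of 1 "9 ^ M" c] c_pos by simp
  ultimately have "\<bar>c\<^sup>2 * real (l - 1) - real k * V / 9 ^ M\<bar> \<le> 4 * 9 ^ M * c"
    using l(2) unfolding abs_le_iff by (simp add: mult.commute mult.left_commute)
  then show ?thesis unfolding quadratic_variation_eq[OF l(1)] by simp
qed

end

text \<open>For fixed \<open>M\<close> the error at the times \<open>k / 9 ^ M\<close> tends to 0
  with the mesh. A general \<open>t\<close> is squeezed between two neighbouring such times by
  monotonicity.\<close>

lemma quadratic_variation_limit:
  fixes P t :: real and c r :: "nat \<Rightarrow> real"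
  assumes part: "\<And>N. peano_partition (c N) (r N) N"
    and c: "\<And>N. c N = P / 3 ^ N" and t: "t \<in> {0..1}"
  shows "(\<lambda>N. quadratic_variation peano_x (c N) (r N) 0 t) \<longlonglongrightarrow> (P - 3 / 4 * P\<^sup>2) * t"
proof -
  define V where "V = P - 3 / 4 * P\<^sup>2"
  define Q where "Q N s = quadratic_variation peano_x (c N) (r N) 0 s" for N s
  have P: "0 < P" "P \<le> 1"
    using peano_partition.c_le[OF part[of 0]] lebesgue_partition.c_pos
      peano_partition.axioms(1)[OF part[of 0]] c[of 0] by fastforce+
  have V: "V = 3 ^ N * c N - 3 / 4 * (3 ^ N * c N)\<^sup>2" for N by (simp add: V_def c)
  have "0 \<le> V"
    using P mult_left_mono[of P 1 P] by (simp add: V_def power2_eq_square)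
  have mono: "Q N s \<le> Q N s'" if "s \<le> s'" "s' \<le> 1" for N s s'
    unfolding Q_def by (rule peano_partition.quadratic_variation_mono[OF part that])
  have lim: "(\<lambda>N. Q N (real k / 9 ^ M)) \<longlonglongrightarrow> real k / 9 ^ M * V" if k: "k \<le> 9 ^ M" for k M
  proof -
    have "\<bar>Q N (real k / 9 ^ M) - real k / 9 ^ M * V\<bar> \<le> 4 * 9 ^ M * c N" if "M \<le> N" for N
      unfolding Q_def V[of N]
      by (rule peano_partition.quadratic_variation_triadic_bound[OF part that k])
    then have ev: "\<forall>\<^sub>F N in sequentially. norm (Q N (real k / 9 ^ M) - real k / 9 ^ M * V) \<le> 4 * 9 ^ M * c N"
      unfolding eventually_sequentially by auto
    have "(\<lambda>N. 4 * 9 ^ M * (P * (1/3) ^ N)) \<longlonglongrightarrow> 4 * 9 ^ M * (P * 0)"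
      by (intro tendsto_intros LIMSEQ_power_zero) auto
    then have "(\<lambda>N. 4 * 9 ^ M * c N) \<longlonglongrightarrow> 0" by (simp add: c power_divide)
    from Lim_null_comparison[OF ev this] show ?thesis by (rule LIM_zero_cancel)
  qed
  have "(\<lambda>N. Q N t) \<longlonglongrightarrow> t * V"
  proof (cases "t = 1")
    case True
    then show ?thesis using lim[of 1 0] by simp
  next
    case False
    show ?thesis
    proof (rule LIMSEQ_I)
      fix e :: real assume "e > 0"
      \<comment> \<open>\<open>V + 1\<close> is a positive denominator, given
        \<open>0 \<le> V\<close>. The aim is that the limits at the two neighbours differ by less
        than \<open>e / 2\<close>.\<close>
      then have "e / (2 * (V + 1)) > 0" using \<open>0 \<le> V\<close> by simp
      then obtain M where "(1/9::real) ^ M < e / (2 * (V + 1))"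
        using real_arch_pow_inv[of "e / (2 * (V + 1))" "1/9"] by auto
      then have "(V + 1) * (1 / 9 ^ M) < e / 2" using \<open>0 \<le> V\<close> by (simp add: field_simps)
      moreover have "(V + 1) * (1 / 9 ^ M) = V * (1 / 9 ^ M) + 1 / 9 ^ M"
        by (simp add: field_simps)
      ultimately have small: "1 / 9 ^ M * V < e / 2"
        by (smt (verit) mult.commute zero_less_divide_1_iff zero_less_power)
      define k where "k = nat \<lfloor>9 ^ M * t\<rfloor>"
      have k: "real k \<le> 9 ^ M * t" "9 ^ M * t < real k + 1"
        unfolding k_def using t by (simp, simp)
      \<comment> \<open>\<open>t < 1\<close> keeps the right neighbour \<open>Suc k / 9 ^ M\<close>
        inside the unit interval.\<close>
      have "9 ^ M * t < 9 ^ M" using False t by simp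
      then have "real k < 9 ^ M" using k by linarith
      then have k': "k < 9 ^ M" by (metis of_nat_less_iff of_nat_numeral of_nat_power)
      define a where "a = real k / 9 ^ M"
      define b where "b = real (Suc k) / 9 ^ M"
      have ab: "a \<le> t" "t \<le> b" "b = a + 1 / 9 ^ M"
        using k by (auto simp: a_def b_def field_simps)
      have "b \<le> 1"
      proof -
        have "real (Suc k) \<le> 9 ^ M" using k' by (metis Suc_leI of_nat_le_iff of_nat_numeral of_nat_power)
        then show ?thesis by (simp add: b_def)
      qed
      have aV: "a * V \<le> t * V" "t * V \<le> b * V" "b * V = a * V + 1 / 9 ^ M * V"
        using mult_right_mono[OF ab(1) \<open>0 \<le> V\<close>] mult_right_mono[OF ab(2) \<open>0 \<le> V\<close>]
        by (simp_all add: ab(3) distrib_right)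
      have "(\<lambda>N. Q N a) \<longlonglongrightarrow> a * V" "(\<lambda>N. Q N b) \<longlonglongrightarrow> b * V"
        using lim[of k M] lim[of "Suc k" M] k' by (simp_all add: a_def b_def)
      then obtain n1 n2 where n: "\<And>N. N \<ge> n1 \<Longrightarrow> norm (Q N a - a * V) < e / 2"
          "\<And>N. N \<ge> n2 \<Longrightarrow> norm (Q N b - b * V) < e / 2"
        using LIMSEQ_D[of _ _ "e / 2"] \<open>e > 0\<close> by (metis half_gt_zero)
      have t1: "t \<le> 1" using t by simp
      have "norm (Q N t - t * V) < e" if "N \<ge> n1" "N \<ge> n2" for N
        using n(1)[OF that(1)] n(2)[OF that(2)] mono[OF ab(1) t1, of N] mono[OF ab(2) \<open>b \<le> 1\<close>, of N]
          aV small unfolding real_norm_def by linarith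
      then show "\<exists>n0. \<forall>N\<ge>n0. norm (Q N t - t * V) < e"
        by (metis max.bounded_iff)
    qed
  qed
  then show ?thesis by (simp add: Q_def V_def mult.commute)
qed

section \<open>Normalisation of the mesh and conclusion\<close>

text \<open>Written as a power of 3, the product has exponent \<open>e + log 3 p\<close>, which lies
  above -1 and is at most 0.\<close>

lemma powi_log_bounds:
  fixes p :: real
  assumes "p > 0"
  defines "e \<equiv> \<lfloor>- log 3 p\<rfloor>"
  shows "3 powi e * p \<le> 1" "1 / 3 < 3 powi e * p"
proof -
  have p: "p = 3 powr (log 3 p)" using assms(1) by simp
  have eq: "3 powi e * p = 3 powr (of_int e + log 3 p)"
    using assms(1) by (simp add: powr_add powr_real_of_int')
  have "of_int e \<le> - log 3 p" "- log 3 p < of_int e + 1" unfolding e_def by linarith+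
  then have "of_int e + log 3 p \<le> 0" "- 1 < of_int e + log 3 p" by linarith+
  then have "3 powr (of_int e + log 3 p) \<le> (3::real) powr 0"
    "(3::real) powr (- 1) < 3 powr (of_int e + log 3 p)"
    by (auto simp only: powr_mono powr_less_mono one_less_numeral_iff semiring_norm one_le_numeral)
  then show "3 powi e * p \<le> 1" "1 / 3 < 3 powi e * p"
    unfolding eq by (simp_all add: powr_minus_divide)
qed

theorem theorem2p3:
  fixes p' q' :: nat and p r \<theta> t :: real
  assumes "p' > 0" and "q' > 0"
    and "\<not> 3 dvd p'" and "\<not> 3 dvd q'"
    and "p = real p' / real q'"
    and "r = \<theta> * p"
    and "\<forall>(m::int) (j::int). \<theta> \<noteq> of_int j * (3 powi m / real p')"
    and "t \<in> {0..1}"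
  shows "(\<lambda>n::nat. quadratic_variation peano_x (3 powi (- int n) * p) (3 powi (- int n) * r) 0 t)
    \<longlonglongrightarrow> 3 powi \<lfloor>- log 3 p\<rfloor> * p * (1 - 3 / 4 * 3 powi \<lfloor>- log 3 p\<rfloor> * p) * t"
proof -
  have p_pos: "p > 0" using assms by simp
  define e where "e = \<lfloor>- log 3 p\<rfloor>"
  define P where "P = 3 powi e * p"
  define cN where "cN N = P / 3 ^ N" for N
  define rN where "rN N = 3 powi e * r / 3 ^ N" for N
  have P: "P \<le> 1" "1 / 3 < P"
    unfolding P_def e_def by (rule powi_log_bounds[OF p_pos])+
  \<comment> \<open>A triadic grid point would make \<open>\<theta> * p'\<close> equal to
    \<open>i * q' * 3 powi a - q * p'\<close> with an integer exponent \<open>a\<close>, that is, an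
    integer times a power of 3.\<close>
  have no_triadic: "real i / 3 ^ j \<notin> grid (cN N) (rN N)" for i j N
  proof
    assume "real i / 3 ^ j \<in> grid (cN N) (rN N)"
    then obtain q where q: "real i / 3 ^ j = cN N * of_int q + rN N" by (auto simp: grid_def)
    define z :: real where "z = 3 powi (int N - e - int j)"
    have "3 powi e * p / 3 ^ N * (of_int q + \<theta>) = real i / 3 ^ j"
      unfolding q cN_def rN_def P_def assms(6) by (simp add: field_simps)
    then have "p * (of_int q + \<theta>) = real i / 3 ^ j * 3 ^ N / 3 powi e"
      by (simp add: field_simps)
    also have "\<dots> = real i * z"
      unfolding z_def by (simp add: power_int_diff power_int_of_nat)
    finally have "real p' * (of_int q + \<theta>) = real i * real q' * z"
      using assms(1,2,5) by (simp add: field_simps)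
    then have \<theta>: "\<theta> = (real i * real q' * z - of_int q * real p') / real p'"
      using assms(1) by (simp add: field_simps)
    define a where "a = int N - e - int j"
    have nn: "0 \<le> a + \<bar>a\<bar>" by simp
    \<comment> \<open>Extracting \<open>3 powi (- \<bar>a\<bar>)\<close> leaves nonnegative
      exponents whatever the sign of \<open>a\<close>, so the cofactor is an integer.\<close>
    have z: "z = 3 ^ nat (a + \<bar>a\<bar>) * 3 powi (- \<bar>a\<bar>)"
      unfolding z_def a_def[symmetric] using nn by (simp add: power_int_add[symmetric] flip: power_int_of_nat)
    have one: "1 = 3 ^ nat \<bar>a\<bar> * (3::real) powi (- \<bar>a\<bar>)"
      by (simp add: power_int_add[symmetric] flip: power_int_of_nat)
    have "real i * real q' * z - of_int q * real p'
      = of_int (int i * int q' * 3 ^ nat (a + \<bar>a\<bar>) - q * int p' * 3 ^ nat \<bar>a\<bar>) * 3 powi (- \<bar>a\<bar>)"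
      using one unfolding z by (simp add: algebra_simps)
    with \<theta> have "\<theta> = of_int (int i * int q' * 3 ^ nat (a + \<bar>a\<bar>) - q * int p' * 3 ^ nat \<bar>a\<bar>)
        * (3 powi (- \<bar>a\<bar>) / real p')"
      by simp
    then show False using assms(7) by blast
  qed
  have part: "peano_partition (cN N) (rN N) N" for N
  proof
    show "continuous_on {0..1} peano_x" by (rule continuous_on_peano_x)
    show "0 < cN N" using P by (simp add: cN_def)
    show "cN N \<le> 1 / 3 ^ N" using P by (simp add: cN_def divide_right_mono)
    show "1 / 3 ^ Suc N < cN N" using P by (simp add: cN_def field_simps)
  qed (rule no_triadic)
  have lim: "(\<lambda>N. quadratic_variation peano_x (cN N) (rN N) 0 t) \<longlonglongrightarrow> (P - 3 / 4 * P\<^sup>2) * t"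
    by (rule quadratic_variation_limit[OF part _ assms(8)]) (simp add: cN_def)
  \<comment> \<open>The given grid of index \<open>n\<close> is the normalised one of index
    \<open>n + e\<close>. This is a natural number once \<open>n \<ge> \<bar>e\<bar>\<close>, so the
    identification holds eventually.\<close>
  have "filterlim (\<lambda>n. nat (int n + e)) sequentially sequentially"
    unfolding filterlim_at_top
  proof
    fix Z show "\<forall>\<^sub>F n in sequentially. Z \<le> nat (int n + e)"
      using eventually_ge_at_top[of "Z + nat \<bar>e\<bar>"] by eventually_elim auto
  qed
  from filterlim_compose[OF lim this]
  have "(\<lambda>n. quadratic_variation peano_x (cN (nat (int n + e))) (rN (nat (int n + e))) 0 t)
      \<longlonglongrightarrow> (P - 3 / 4 * P\<^sup>2) * t" .
  moreover have "\<forall>\<^sub>F n in sequentially.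
      quadratic_variation peano_x (cN (nat (int n + e))) (rN (nat (int n + e))) 0 t
      = quadratic_variation peano_x (3 powi (- int n) * p) (3 powi (- int n) * r) 0 t"
    using eventually_ge_at_top[of "nat \<bar>e\<bar>"]
  proof eventually_elim
    case (elim n)
    then have "(3::real) ^ nat (int n + e) = 3 powi (int n + e)"
      by (subst power_int_of_nat[symmetric]) simp
    then have "3 powi e / (3::real) ^ nat (int n + e) = 3 powi (- int n)"
      by (simp add: power_int_add power_int_minus field_simps)
    then have "cN (nat (int n + e)) = 3 powi (- int n) * p"
      "rN (nat (int n + e)) = 3 powi (- int n) * r"
      unfolding cN_def rN_def P_def by (metis times_divide_eq_left)+
    then show ?case by simp
  qed
  ultimately have "(\<lambda>n. quadratic_variation peano_x (3 powi (- int n) * p) (3 powi (- int n) * r) 0 t)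
      \<longlonglongrightarrow> (P - 3 / 4 * P\<^sup>2) * t"
    by (rule Lim_transform_eventually)
  moreover have "(P - 3 / 4 * P\<^sup>2) * t
      = 3 powi e * p * (1 - 3 / 4 * 3 powi e * p) * t"
    by (simp add: P_def power2_eq_square algebra_simps)
  ultimately show ?thesis unfolding e_def by (simp only:)
qed

end
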